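(* Let $n$ be a positive integer and let $\beta_1\in\mathrm{Un}(\mathbf{Z}[\alpha])$. Then $u_{\chi_1}(\beta_1)\in\mathrm{V}(\mathbf{Z}G)$ if and only if both of the following hold: 1) $\beta_1\in\mathrm{Un}(\mathbf{Z}[\alpha+\alpha^{-1}])=\langle-1\rangle\times K$; 2) $\beta_1\equiv1\pmod 2$.
   Context: Let $\alpha=e^{2\pi i/2^n}$, $\mathbf{Q}_{2^n}=\mathbf{Q}(\alpha)$, with ring of integers $\mathbf{Z}[\alpha]$; $\mathrm{Un}(R)$ denotes the unit group of a ring $R$. The group $K$ is a subgroup of $\mathrm{Un}(\mathbf{Z}[\alpha+\alpha^{-1}])\subset\mathbf{R}$ such that $\mathrm{Un}(\mathbf{Z}[\alpha])=\langle\alpha\rangle\times K$ (such a $K$ exists). For $\rho,\sigma\in\mathbf{Z}[\alpha]$, $\rho\equiv\sigma\pmod 2$ means $\rho-\sigma\in2\mathbf{Z}[\alpha]$. Let $G=\langle x\rangle$ be the cyclic group of order $2^n$, $\chi_1$ the character of $G$ with $\chi_1(x)=\alpha$, and $\mathrm{V}(\mathbf{Z}G)$ the group of normalized units (units of augmentation $1$) of $\mathbf{Z}G$. For $\beta\in\mathrm{Un}(\mathbf{Z}[\alpha])$ the element $u_{\chi_1}(\beta)=\sum_{j=0}^{2^n-1}\gamma_jx^j\in\mathbf{Q}G$ is given by $\gamma_0=1+\frac{1}{2^n}\mathrm{tr}(\beta-1)$ and $\gamma_j=\frac1{2^n}\mathrm{tr}\big((\beta-1)\alpha^{-j}\big)$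 for $1\le j\le2^n-1$, where $\mathrm{tr}$ is the trace from $\mathbf{Q}_{2^n}$ to $\mathbf{Q}$; $u_{\chi_1}$ is multiplicative in $\beta$. *)

theory Defs
  imports "HOL-Algebra.Algebraic_Closure_Type" "HOL-Algebra.Generated_Fields" "HOL-Algebra.Elementary_Groups"
begin

text \<open>All rings of numbers below are subrings of the field of complex numbers, seen as a
  HOL-Algebra ring with a restricted carrier.\<close>

abbreviation complex_ring :: "complex ring" where
  "complex_ring \<equiv> ring_of_type_algebra"

abbreviation complex_subring :: "complex set \<Rightarrow> complex ring" where
  "complex_subring S \<equiv> complex_ring\<lparr>carrier := S\<rparr>"

definition zeta :: "nat \<Rightarrow> complex" where
  "zeta n = exp (2 * complex_of_real pi * \<i> / 2 ^ n)"

definition cyclo_int :: "nat \<Rightarrow> complex ring" where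
  "cyclo_int n = complex_subring (generate_ring complex_ring {zeta n})"

definition real_cyclo_int :: "nat \<Rightarrow> complex ring" where
  "real_cyclo_int n = complex_subring (generate_ring complex_ring {zeta n + inverse (zeta n)})"

definition cyclo_field :: "nat \<Rightarrow> complex set" where
  "cyclo_field n = generate_field complex_ring {zeta n}"

definition cong_two :: "nat \<Rightarrow> complex \<Rightarrow> complex \<Rightarrow> bool" where
  "cong_two n a b \<longleftrightarrow> a - b \<in> (\<lambda>t. 2 * t) ` carrier (cyclo_int n)"


text \<open>The trace to the rationals of a number field \<open>L\<close> inside the complex numbers, as the sum
  over all field embeddings of \<open>L\<close> into the complex numbers. Membership in
  \<^term>\<open>extensional L\<close> makes every embedding occur exactly once, as \<^const>\<open>ring_hom\<close> does not
  restrict the values outside of \<open>L\<close>.\<close>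

definition embeddings :: "complex set \<Rightarrow> (complex \<Rightarrow> complex) set" where
  "embeddings L = ring_hom (complex_subring L) complex_ring \<inter> extensional L"

definition field_trace :: "complex set \<Rightarrow> complex \<Rightarrow> complex" where
  "field_trace L a = (\<Sum>\<sigma>\<in>embeddings L. \<sigma> a)"


definition internal_direct_product ::
    "('a, 'm) monoid_scheme \<Rightarrow> 'a set \<Rightarrow> 'a set \<Rightarrow> bool" where
  "internal_direct_product G A B \<longleftrightarrow>
     A \<lhd> G \<and> B \<lhd> G \<and> A \<inter> B = {\<one>\<^bsub>G\<^esub>} \<and> A <#>\<^bsub>G\<^esub> B = carrier G"


text \<open>The group ring: the element \<open>\<Sum>g. a g \<cdot> g\<close> is represented by its finitely supported
  coefficient function \<open>a\<close>, which is \<^const>\<open>undefined\<close> outside of \<^term>\<open>carrier G\<close>.\<close>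

definition group_ring_supp ::
    "('r, 'k) ring_scheme \<Rightarrow> ('g, 'm) monoid_scheme \<Rightarrow> ('g \<Rightarrow> 'r) \<Rightarrow> 'g set" where
  "group_ring_supp R G a = {g \<in> carrier G. a g \<noteq> \<zero>\<^bsub>R\<^esub>}"

definition group_ring ::
    "('r, 'k) ring_scheme \<Rightarrow> ('g, 'm) monoid_scheme \<Rightarrow> ('g \<Rightarrow> 'r) ring" where
  "group_ring R G =
     \<lparr>carrier = {a \<in> carrier G \<rightarrow>\<^sub>E carrier R. finite (group_ring_supp R G a)},
      monoid.mult = (\<lambda>a b. \<lambda>g\<in>carrier G.
        \<Oplus>\<^bsub>R\<^esub>h\<in>group_ring_supp R G a. a h \<otimes>\<^bsub>R\<^esub> b (inv\<^bsub>G\<^esub> h \<otimes>\<^bsub>G\<^esub> g)),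
      one = (\<lambda>g\<in>carrier G. if g = \<one>\<^bsub>G\<^esub> then \<one>\<^bsub>R\<^esub> else \<zero>\<^bsub>R\<^esub>),
      ring.zero = (\<lambda>g\<in>carrier G. \<zero>\<^bsub>R\<^esub>),
      add = (\<lambda>a b. \<lambda>g\<in>carrier G. a g \<oplus>\<^bsub>R\<^esub> b g)\<rparr>"

definition augmentation ::
    "('r, 'k) ring_scheme \<Rightarrow> ('g, 'm) monoid_scheme \<Rightarrow> ('g \<Rightarrow> 'r) \<Rightarrow> 'r" where
  "augmentation R G a = (\<Oplus>\<^bsub>R\<^esub>g\<in>group_ring_supp R G a. a g)"

definition normalized_units ::
    "('r, 'k) ring_scheme \<Rightarrow> ('g, 'm) monoid_scheme \<Rightarrow> ('g \<Rightarrow> 'r) set" where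
  "normalized_units R G = {u \<in> Units (group_ring R G). augmentation R G u = \<one>\<^bsub>R\<^esub>}"


definition u_coeff :: "nat \<Rightarrow> complex \<Rightarrow> nat \<Rightarrow> complex" where
  "u_coeff n \<beta> j =
     (if j = 0 then 1 + 1 / 2 ^ n * field_trace (cyclo_field n) (\<beta> - 1)
      else 1 / 2 ^ n * field_trace (cyclo_field n) ((\<beta> - 1) * inverse (zeta n) ^ j))"

text \<open>The coefficient function of \<open>\<Sum>j<2^n. u_coeff n \<beta> j \<cdot> x^j\<close>, that is, \<open>u(\<beta>)\<close> for the character
  mapping the generator \<open>x\<close> to \<^term>\<open>zeta n\<close>.\<close>

definition u_elem ::
    "nat \<Rightarrow> ('g, 'm) monoid_scheme \<Rightarrow> 'g \<Rightarrow> complex \<Rightarrow> ('g \<Rightarrow> complex)" where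
  "u_elem n G x \<beta> = (\<lambda>g\<in>carrier G. \<Sum>j | j < 2 ^ n \<and> x [^]\<^bsub>G\<^esub> j = g. u_coeff n \<beta> j)"

end

theory Submission
  imports Defs
begin

text \<open>
  Under the embeddings of \<open>\<rat>(zeta n)\<close>, which send \<open>zeta n\<close> to the \<open>2 ^ (n - 1)\<close> roots \<open>z\<close> of
  \<open>X ^ 2 ^ (n - 1) + 1\<close>, the trace becomes a sum over these roots. The element \<open>u(\<beta>)\<close> takes the value
  \<open>\<sigma> \<beta>\<close> at the faithful character \<open>x \<mapsto> \<sigma> (zeta n)\<close>, and the value \<open>1\<close> at all other characters. The
  proof of the theorem has two independent halves.

  Integrality. The trace recovers the coefficients of an algebraic integer with respect to the power
  basis \<open>1, zeta n, ..., zeta n ^ (2 ^ (n - 1) - 1)\<close>, which shows that \<open>u(\<beta>)\<close> has integral coefficients if and only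
  if \<open>\<beta>\<close> is congruent to \<open>1\<close> modulo \<open>2\<close> (\<open>u_coeff_integral_iff\<close>). As \<open>u\<close> is multiplicative
  (\<open>u_poly_coeff_convolution\<close>) and the congruence passes from \<open>\<beta>\<close> to its inverse, the congruence characterizes
  the \<open>\<beta>\<close> for which \<open>u(\<beta>)\<close> is a unit of the integral group ring; its augmentation is always \<open>1\<close>.

  Reality. A unit \<open>\<beta>\<close> is a power of \<open>zeta n\<close> times a real unit, so \<open>\<beta>\<close> and its conjugate differ by an
  even power of \<open>zeta n\<close>. A unit congruent to \<open>1\<close> modulo \<open>2\<close> is real, because the trace of such
  a power would otherwise have the wrong parity (\<open>cong_two_imp_real\<close>). The decomposition of the real units
  follows from the given one, as the only real powers of \<open>zeta n\<close> are \<open>1\<close> and \<open>-1\<close>.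

  Both halves need that all roots \<open>z\<close> really belong to embeddings, that is, the irreducibility of
  \<open>X ^ 2 ^ (n - 1) + 1\<close>. It is proved for integer polynomials by the Eisenstein argument at \<open>z - 1\<close>
  (\<open>coeffs_even_if_root\<close>, \<open>int_power_combination_zero_imp_zero\<close>).\<close>

section \<open>Integer polynomials at roots of \<open>X ^ 2 ^ k + 1\<close>\<close>

definition int_eval :: "int poly \<Rightarrow> 'a::comm_ring_1 \<Rightarrow> 'a" where
  "int_eval P z = poly (map_poly of_int P) z"

lemma int_eval_0 [simp]: "int_eval 0 z = 0"
  by (simp add: int_eval_def)

lemma int_eval_pCons [simp]: "int_eval (pCons a P) z = of_int a + z * int_eval P z"
  by (simp add: int_eval_def map_poly_pCons)

lemma int_eval_1 [simp]: "int_eval 1 z = 1"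
  by (simp add: one_pCons)

lemma int_eval_numeral [simp]: "int_eval (numeral m) z = numeral m"
  by (simp add: numeral_poly)

lemma int_eval_add [simp]: "int_eval (P + Q) z = int_eval P z + int_eval Q z"
  by (induction P Q rule: poly_induct2) (simp_all add: algebra_simps)

lemma int_eval_smult [simp]: "int_eval (smult a P) z = of_int a * int_eval P z"
  by (induction P) (simp_all add: algebra_simps)

lemma int_eval_mult [simp]: "int_eval (P * Q) z = int_eval P z * int_eval Q z"
  by (induction P) (simp_all add: algebra_simps)

lemma int_eval_minus [simp]: "int_eval (- P) z = - int_eval P z"
  using int_eval_smult[of "-1" P z] by simp

lemma int_eval_diff [simp]: "int_eval (P - Q) z = int_eval P z - int_eval Q z"
  using int_eval_add[of P "- Q" z] by simp

lemma int_eval_power [simp]: "int_eval (P ^ k) z = int_eval P z ^ k"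
  by (induction k) simp_all

lemma int_eval_monom [simp]: "int_eval (monom a k) z = of_int a * z ^ k"
  by (induction k) (simp_all add: monom_0 monom_Suc algebra_simps)

lemma int_eval_sum [simp]: "int_eval (\<Sum>i\<in>A. f i) z = (\<Sum>i\<in>A. int_eval (f i) z)"
  by (induction A rule: infinite_finite_induct) simp_all

lemma int_eval_pcompose [simp]: "int_eval (pcompose P Q) z = int_eval P (int_eval Q z)"
  by (induction P) (simp_all add: pcompose_pCons)

lemma of_int_poly_1: "of_int (poly P 1) = int_eval P 1"
  by (induction P) simp_all

text \<open>The even part \<open>A\<close> and the odd part \<open>B\<close> of a polynomial: \<open>A(X\<^sup>2) \<plusminus> X B(X\<^sup>2)\<close> are its values at
  \<open>\<plusminus>X\<close>, whose product \<open>A(Y)\<^sup>2 - Y B(Y)\<^sup>2\<close> at \<open>Y = X\<^sup>2\<close> is the relative norm used in the descent below.\<close>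

lemma int_poly_even_odd_split:
  fixes P :: "int poly"
  obtains A B where "\<And>z :: 'a :: comm_ring_1. int_eval P z = int_eval A (z^2) + z * int_eval B (z^2)"
    and "poly P 1 = poly A 1 + poly B 1"
proof -
  have "\<exists>A B. (\<forall>z :: 'a. int_eval P z = int_eval A (z^2) + z * int_eval B (z^2))
             \<and> poly P 1 = poly A 1 + poly B 1"
  proof (induction P)
    case 0
    show ?case by (intro exI[of _ 0]) simp
  next
    case (pCons a P)
    then obtain A B where "\<forall>z :: 'a. int_eval P z = int_eval A (z^2) + z * int_eval B (z^2)"
      and "poly P 1 = poly A 1 + poly B 1" by blast
    then show ?case
      by (intro exI[of _ "pCons a B"] exI[of _ A]) (simp add: algebra_simps power2_eq_square)
  qed
  then show thesis using that by blast
qed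

text \<open>The quotient of \<open>\<int>[z]\<close> by the prime above \<open>2\<close> is the field with two elements, and \<open>z\<close> is mapped to \<open>1\<close>; so a
  value that is odd at \<open>1\<close> cannot vanish. The proof does not construct this quotient: taking the
  norm \<open>P(X) P(-X) = Q(X\<^sup>2)\<close> replaces \<open>z\<close> by \<open>z\<^sup>2\<close>, keeps the value at \<open>1\<close> odd, and ends at \<open>z = 1\<close>.\<close>

lemma int_eval_nonzero_if_odd_at_1:
  fixes z :: "'a :: {comm_ring_1, ring_char_0}"
  assumes "z ^ 2 ^ k = 1" and "odd (poly P 1)"
  shows "int_eval P z \<noteq> 0"
  using assms
proof (induction k arbitrary: z P)
  case 0
  then have "int_eval P z = of_int (poly P 1)"
    by (simp add: of_int_poly_1)
  with 0 show ?case by auto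
next
  case (Suc k)
  obtain A B where AB: "\<And>z :: 'a. int_eval P z = int_eval A (z^2) + z * int_eval B (z^2)"
      "poly P 1 = poly A 1 + poly B 1"
    using int_poly_even_odd_split by blast
  let ?Q = "A ^ 2 - [:0, 1:] * B ^ 2"
  have "int_eval ?Q (z^2) = int_eval P z * (int_eval A (z^2) - z * int_eval B (z^2))"
    by (simp add: AB algebra_simps power2_eq_square)
  moreover have "int_eval ?Q (z^2) \<noteq> 0"
  proof (rule Suc.IH)
    show "(z\<^sup>2) ^ 2 ^ k = 1"
      using Suc.prems(1) by (simp add: power_mult[symmetric])
    show "odd (poly ?Q 1)"
      using Suc.prems(2) by (simp add: AB(2) poly_power)
  qed
  ultimately show ?case by auto
qed

lemma X_plus_1_power_two_power:
  obtains H :: "int poly"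
    where "[:1, 1:] ^ 2 ^ k = monom 1 (2 ^ k) + 1 + 2 * pCons 0 H"
proof -
  have "\<exists>H :: int poly. [:1, 1:] ^ 2 ^ k = monom 1 (2 ^ k) + 1 + 2 * pCons 0 H"
  proof (induction k)
    case 0
    show ?case by (intro exI[of _ 0]) (simp add: monom_altdef one_pCons)
  next
    case (Suc k)
    then obtain H :: "int poly"
      where H: "[:1, 1:] ^ 2 ^ k = monom 1 (2 ^ k) + 1 + 2 * pCons 0 H" by blast
    define M :: "int poly" where "M = monom 1 (2 ^ k)"
    obtain M' where M': "M = pCons 0 M'"
    proof -
      have "M = monom 1 (Suc (2 ^ k - 1))" by (simp add: M_def)
      then show thesis using that by (simp only: monom_Suc)
    qed
    have "[:1, 1:] ^ 2 ^ Suc k = ([:1, 1:] ^ 2 ^ k)\<^sup>2"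
      by (simp add: power_mult[symmetric] mult.commute)
    also have "\<dots> = (M + 1 + 2 * pCons 0 H)\<^sup>2"
      by (simp only: H M_def)
    also have "\<dots> = M\<^sup>2 + 1 + 2 * (M + pCons 0 H * (2 * M + 2 + 2 * pCons 0 H))"
      by (simp only: power2_eq_square ring_distribs) (simp add: ac_simps mult_2)
    also have "M\<^sup>2 = monom 1 (2 ^ Suc k)"
      by (simp add: M_def power2_eq_square mult_monom mult_2)
    also have "M + pCons 0 H * (2 * M + 2 + 2 * pCons 0 H) =
        pCons 0 (M' + H * (2 * M + 2 + 2 * pCons 0 H))"
      by (simp add: M')
    finally show ?case by blast
  qed
  then show thesis using that by blast
qed


text \<open>This is the Eisenstein argument at \<open>w = z - 1\<close>. Here \<open>w ^ 2 ^ k = - 2 E(w)\<close> with \<open>E(0) = 1\<close>, so that \<open>2\<close> is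
  \<open>w ^ 2 ^ k\<close> up to an element that is odd at \<open>1\<close>. In the expansion of \<open>P\<close> in powers of \<open>w\<close>, let \<open>r\<close> be
  the first index with an odd coefficient. Multiplication by \<open>E(w)\<close> turns the even coefficients before \<open>r\<close>
  into multiples of \<open>w ^ 2 ^ k\<close>, and after division by \<open>w ^ r\<close> there remains a vanishing
  polynomial expression that is odd at \<open>1\<close>.\<close>

lemma coeffs_even_if_root:
  fixes z :: "'a :: {idom, ring_char_0}"
  assumes z: "z ^ 2 ^ k = -1" and "degree P < 2 ^ k" and root: "int_eval P z = 0"
  shows "even (coeff P i)"
proof -
  define N :: nat where "N = 2 ^ k"
  define Q where "Q = pcompose P [:1, 1:]"
  define w where "w = z - 1"
  have "w \<noteq> 0"
    using z by (auto simp: w_def)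
  obtain H :: "int poly" where H: "[:1, 1:] ^ N = monom 1 N + 1 + 2 * pCons 0 H"
    unfolding N_def using X_plus_1_power_two_power by blast
  define E where "E = pCons 1 H"
  have w_pow: "w ^ N = - 2 * int_eval E w"
  proof -
    have "-1 = int_eval ([:1, 1:] ^ N) w"
      using z by (simp add: N_def w_def)
    then show ?thesis
      by (simp add: H E_def algebra_simps eq_neg_iff_add_eq_0)
  qed
  have Q_root: "int_eval Q w = 0"
    using root by (simp add: Q_def w_def)
  have Q_even: "even (coeff Q r)" for r
  proof (induction r rule: less_induct)
    case (less r)
    show ?case
    proof (rule ccontr)
      assume odd: "odd (coeff Q r)"
      have "degree Q = degree P"
        by (simp add: Q_def degree_pcompose)
      moreover have "r \<le> degree Q"
        using odd by (intro le_degree) auto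
      ultimately have "r < N"
        using assms(2) by (simp add: N_def)
      have "[:2:] dvd poly_cutoff r Q"
        using less by (simp add: const_poly_dvd_iff coeff_poly_cutoff)
      then obtain A where A: "poly_cutoff r Q = 2 * A"
        by (auto simp: dvd_def numeral_poly)
      define S where "S = poly_shift r Q"
      have Q_split: "Q = 2 * A + monom 1 r * S"
        by (rule poly_eqI) (auto simp: A[symmetric] S_def coeff_poly_cutoff coeff_monom_mult coeff_poly_shift)
      define F where "F = E * S - monom 1 (N - r) * A"
      have "w ^ r * int_eval F w = 0"
      proof -
        have "w ^ r * int_eval F w = int_eval E w * (w ^ r * int_eval S w) - w ^ N * int_eval A w"
          using \<open>r < N\<close> by (simp add: F_def algebra_simps flip: power_add)
        also have "\<dots> = int_eval E w * int_eval Q w"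
          by (simp add: w_pow Q_split algebra_simps)
        finally show ?thesis
          by (simp add: Q_root)
      qed
      then have F_root: "int_eval F w = 0"
        using \<open>w \<noteq> 0\<close> by simp
      have "int_eval (pcompose F [:-1, 1:]) z \<noteq> 0"
      proof (rule int_eval_nonzero_if_odd_at_1)
        have "z ^ 2 ^ Suc k = (z ^ 2 ^ k)\<^sup>2"
          by (simp add: power_mult[symmetric] mult.commute)
        then show "z ^ 2 ^ Suc k = 1"
          by (simp add: z)
        have "poly F 0 = coeff Q r"
          using \<open>r < N\<close> by (simp add: F_def E_def S_def poly_monom poly_0_coeff_0 coeff_poly_shift coeff_monom_mult)
        then show "odd (poly (pcompose F [:-1, 1:]) 1)"
          using odd by (simp add: poly_pcompose)
      qed
      with F_root show False
        by (simp add: w_def algebra_simps)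
    qed
  qed
  have "P = pcompose Q [:-1, 1:]"
    by (simp add: Q_def pcompose_assoc[symmetric] pcompose_pCons)
  moreover have "[:2:] dvd Q"
    using Q_even by (simp add: const_poly_dvd_iff)
  then obtain B where "Q = [:2:] * B" ..
  ultimately have "P = [:2:] * pcompose B [:-1, 1:]"
    by (simp add: pcompose_smult)
  then show ?thesis
    by simp
qed

text \<open>This is the irreducibility of \<open>X ^ 2 ^ k + 1\<close>: in an integral relation all coefficients are even by the
  previous lemma, and the relation may be halved again and again.\<close>

lemma int_power_combination_zero_imp_zero:
  fixes z :: "'a :: {idom, ring_char_0}"
  assumes z: "z ^ 2 ^ k = -1" and "(\<Sum>j<2 ^ k. of_int (r j) * z ^ j) = 0" and "j < 2 ^ k"
  shows "r j = 0"
proof -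
  have even: "even (r j)"
    if "(\<Sum>j<2 ^ k. of_int (r j) * z ^ j) = 0" and "j < 2 ^ k" for r j
  proof -
    define P where "P = (\<Sum>j<2 ^ k. monom (r j) j)"
    have coeff: "coeff P i = (if i < 2 ^ k then r i else 0)" for i
      by (simp add: P_def coeff_sum sum.delta')
    have "degree P \<le> 2 ^ k - 1"
      by (intro degree_le) (auto simp: coeff)
    then have "degree P < 2 ^ k"
      using zero_less_power[of "2 :: nat" k] by linarith
    then have "even (coeff P j)"
      using that by (intro coeffs_even_if_root[OF z]) (auto simp: P_def)
    then show ?thesis
      using that by (simp add: coeff)
  qed
  have "2 ^ m dvd r j" for m
    using assms(2,3)
  proof (induction m arbitrary: r)
    case (Suc m)
    define s where "s = (\<lambda>i. r i div 2)"
    have r: "r i = 2 * s i" if "i < 2 ^ k" for i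
      using even[OF Suc.prems(1) that] by (simp add: s_def)
    have "2 * (\<Sum>i<2 ^ k. of_int (s i) * z ^ i) = (\<Sum>i<2 ^ k. of_int (r i) * z ^ i)"
      unfolding sum_distrib_left by (intro sum.cong) (simp_all add: r mult.assoc)
    then have "(\<Sum>i<2 ^ k. of_int (s i) * z ^ i) = 0"
      using Suc.prems(1) by simp
    then have "2 ^ m dvd s j"
      using Suc.prems(2) by (rule Suc.IH)
    then show ?case
      by (simp add: r[OF Suc.prems(2)])
  qed simp
  \<comment> \<open>the exponent is chosen so that the power of two exceeds the absolute value of \<open>r j\<close>\<close>
  then have "2 ^ nat \<bar>r j\<bar> dvd r j"
    by blast
  then have "2 ^ nat \<bar>r j\<bar> \<le> \<bar>r j\<bar>" if "r j \<noteq> 0"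
    using dvd_imp_le_int[OF that] by fastforce
  moreover have "int (nat \<bar>r j\<bar>) < int (2 ^ nat \<bar>r j\<bar>)"
    using less_exp[of "nat \<bar>r j\<bar>"] by (subst of_nat_less_iff)
  ultimately show ?thesis
    by (cases "r j = 0") simp_all
qed

text \<open>The remainder modulo \<open>X ^ N + 1\<close>, with coefficients that serve all roots \<open>z\<close> at once.\<close>

lemma int_eval_reduce:
  fixes P :: "int poly"
  assumes "N > 0"
  obtains r :: "nat \<Rightarrow> int"
    where "\<And>z :: 'a :: comm_ring_1. z ^ N = -1 \<Longrightarrow> int_eval P z = (\<Sum>j<N. of_int (r j) * z ^ j)"
proof -
  obtain M where M: "N = Suc M"
    using assms by (cases N) auto
  have "\<exists>r :: nat \<Rightarrow> int. \<forall>z :: 'a. z ^ N = -1 \<longrightarrow> int_eval P z = (\<Sum>j<N. of_int (r j) * z ^ j)"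
  proof (induction P)
    case 0
    show ?case by (intro exI[of _ "\<lambda>_. 0"]) simp
  next
    case (pCons a P)
    then obtain r where r: "\<forall>z :: 'a. z ^ N = -1 \<longrightarrow> int_eval P z = (\<Sum>j<N. of_int (r j) * z ^ j)"
      by blast
    \<comment> \<open>multiplication by \<open>z\<close> shifts the coefficients and \<open>z ^ N = -1\<close> moves the top one to index \<open>0\<close> with a sign\<close>
    define s where "s = (\<lambda>j. case j of 0 \<Rightarrow> a - r M | Suc i \<Rightarrow> r i)"
    have "int_eval (pCons a P) z = (\<Sum>j<N. of_int (s j) * z ^ j)" if z: "z ^ N = -1" for z :: 'a
    proof -
      have "int_eval (pCons a P) z = of_int a + z * (\<Sum>j<Suc M. of_int (r j) * z ^ j)"
        using r z by (simp add: M)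
      also have "\<dots> = of_int a + (\<Sum>j<M. of_int (r j) * z ^ Suc j) + of_int (r M) * z ^ N"
        by (simp add: sum_distrib_left algebra_simps M)
      also have "\<dots> = (\<Sum>j<Suc M. of_int (s j) * z ^ j)"
        unfolding sum.lessThan_Suc_shift z by (simp add: s_def)
      finally show ?thesis by (simp add: M)
    qed
    then show ?case by blast
  qed
  then show thesis using that by blast
qed

text \<open>The roots of \<open>X ^ 2 ^ k + 1\<close> are conjugate over the rationals.\<close>

corollary int_eval_zero_transfer:
  fixes z w :: "'a :: {idom, ring_char_0}"
  assumes "z ^ 2 ^ k = -1" and "w ^ 2 ^ k = -1" and "int_eval P z = 0"
  shows "int_eval P w = 0"
proof -
  obtain r where r: "\<And>z :: 'a. z ^ 2 ^ k = -1 \<Longrightarrow> int_eval P z = (\<Sum>j<2 ^ k. of_int (r j) * z ^ j)"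
    using int_eval_reduce[of "2 ^ k" P] by auto
  have "r j = 0" if "j < 2 ^ k" for j
    using int_power_combination_zero_imp_zero[OF assms(1) _ that] r[OF assms(1)] assms(3) by simp
  then show ?thesis
    using r[OF assms(2)] by simp
qed

section \<open>Sums over the roots of \<open>X ^ 2 ^ k + 1\<close>\<close>

lemma power_eq_1_imp_dvd:
  fixes z :: "'a :: {idom, ring_char_0}"
  assumes "z ^ 2 ^ k = -1" and "z ^ m = 1"
  shows "2 ^ Suc k dvd m"
  using assms
proof (induction k arbitrary: z)
  case 0
  then show ?case by (auto simp: minus_one_power_iff split: if_splits)
next
  case (Suc k)
  have "(z\<^sup>2) ^ 2 ^ k = -1"
    using Suc.prems(1) by (simp add: power_mult[symmetric])
  moreover have "(z\<^sup>2) ^ m = 1"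
    using Suc.prems(2) by (metis mult.commute power_mult power_one)
  ultimately have "2 ^ Suc k dvd m"
    by (rule Suc.IH)
  then obtain q where q: "m = 2 ^ Suc k * q" ..
  have "(-1 :: 'a) ^ q = 1"
    using Suc.prems by (simp only: q power_mult)
  then have "even q"
    by (auto simp: minus_one_power_iff split: if_splits)
  then show ?case
    by (auto simp: q)
qed

abbreviation roots_of_minus_one :: "nat \<Rightarrow> complex set" where
  "roots_of_minus_one k \<equiv> {z. z ^ 2 ^ k = -1}"

lemma card_roots_of_minus_one: "card (roots_of_minus_one k) = 2 ^ k"
  by (simp add: card_nth_roots)

lemma finite_roots_of_minus_one [simp]: "finite (roots_of_minus_one k)"
  by (simp add: finite_nth_roots)

lemma roots_of_minus_one_power_order: "z ^ 2 ^ k = -1 \<Longrightarrow> z ^ 2 ^ Suc k = 1" for z :: complex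
  by (simp add: power_mult mult.commute[of 2])

lemma inverse_power_root_of_minus_one:
  assumes "z \<in> roots_of_minus_one k"
  shows "inverse z ^ j = z ^ ((2 ^ Suc k - 1) * j)"
proof -
  have "z \<noteq> 0"
    using assms by (auto simp: power_0_left)
  have "z * z ^ (2 ^ Suc k - 1) = 1"
    using roots_of_minus_one_power_order[of z k] assms by (simp flip: power_Suc)
  then have "inverse z = z ^ (2 ^ Suc k - 1)"
    by (rule inverse_unique)
  then show ?thesis
    by (simp only: power_mult)
qed

text \<open>Multiplication by \<open>a\<^sup>2\<close>, where \<open>a\<close> is one of the roots, permutes the roots and multiplies the sum by
  \<open>a ^ (2 * m)\<close>, which differs from \<open>1\<close> unless \<open>2 ^ k\<close> divides \<open>m\<close>.\<close>

lemma sum_power_roots_of_minus_one: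
  "(\<Sum>z\<in>roots_of_minus_one k. z ^ m) = (if 2 ^ k dvd m then 2 ^ k * (-1) ^ (m div 2 ^ k) else 0)"
proof (cases "2 ^ k dvd m")
  case True
  then obtain q where q: "m = 2 ^ k * q" ..
  have "(\<Sum>z\<in>roots_of_minus_one k. z ^ m) = (\<Sum>z\<in>roots_of_minus_one k. (-1) ^ q)"
    by (intro sum.cong) (auto simp: q power_mult)
  then show ?thesis
    by (simp add: q card_roots_of_minus_one)
next
  case False
  have "roots_of_minus_one k \<noteq> {}"
    using card_roots_of_minus_one[of k] by force
  then obtain a :: complex where a: "a ^ 2 ^ k = -1"
    by blast
  define w where "w = a\<^sup>2"
  have w: "w ^ 2 ^ k = 1"
    unfolding w_def by (metis a mult.commute power2_minus power_mult power_one)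
  have "w \<noteq> 0"
    using a by (auto simp: w_def power_0_left)
  have "w ^ m \<noteq> 1"
  proof
    assume "w ^ m = 1"
    then have "2 ^ Suc k dvd 2 * m"
      using a by (intro power_eq_1_imp_dvd[of a]) (simp_all add: w_def power_mult)
    with False show False by simp
  qed
  moreover have "(\<Sum>z\<in>roots_of_minus_one k. z ^ m) = (\<Sum>z\<in>roots_of_minus_one k. (w * z) ^ m)"
    by (rule sum.reindex_bij_witness[of _ "\<lambda>z. w * z" "\<lambda>z. z / w"])
       (use w \<open>w \<noteq> 0\<close> in \<open>auto simp: power_mult_distrib power_divide\<close>)
  then have "(1 - w ^ m) * (\<Sum>z\<in>roots_of_minus_one k. z ^ m) = 0"
    by (simp add: power_mult_distrib left_diff_distrib flip: sum_distrib_left)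
  ultimately show ?thesis
    using False by simp
qed

text \<open>Trace duality: the sum over all roots, which is the trace, recovers the coefficients with respect
  to the power basis.\<close>

lemma sum_reduced_times_inverse_power:
  assumes "j < 2 ^ k"
  shows "(\<Sum>z\<in>roots_of_minus_one k. (\<Sum>i<2 ^ k. of_int (r i) * z ^ i) * inverse z ^ j)
       = 2 ^ k * of_int (r j)"
proof -
  have "(\<Sum>z\<in>roots_of_minus_one k. z ^ i * inverse z ^ j) = (if i = j then 2 ^ k else 0)"
    if "i < 2 ^ k" for i
  proof (cases "i = j")
    case True
    have "z ^ i * inverse z ^ j = 1" if "z \<in> roots_of_minus_one k" for z
    proof -
      have "z \<noteq> 0"
        using that by (auto simp: power_0_left)
      then show ?thesis
        by (simp add: True flip: power_mult_distrib)
    qed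
    then show ?thesis
      using True by (simp add: card_roots_of_minus_one)
  next
    case False
    let ?m = "i + (2 ^ Suc k - 1) * j"
    have "(\<Sum>z\<in>roots_of_minus_one k. z ^ i * inverse z ^ j) = (\<Sum>z\<in>roots_of_minus_one k. z ^ ?m)"
      by (intro sum.cong refl) (simp only: inverse_power_root_of_minus_one power_add)
    also have "\<not> 2 ^ k dvd ?m"
    proof
      assume "2 ^ k dvd ?m"
      then have "int (2 ^ k) dvd int ?m"
        by (simp only: int_dvd_int_iff)
      also have "int ?m = int (2 ^ k) * (2 * int j) + (int i - int j)"
        by (simp add: of_nat_diff left_diff_distrib)
      finally have "int (2 ^ k) dvd int i - int j"
        by (subst (asm) dvd_add_right_iff) simp_all
      moreover have "\<bar>int i - int j\<bar> < int (2 ^ k)"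
        using assms that by linarith
      ultimately show False
        using False dvd_imp_le_int[of "int i - int j"] by fastforce
    qed
    then have "(\<Sum>z\<in>roots_of_minus_one k. z ^ ?m) = 0"
      by (simp only: sum_power_roots_of_minus_one if_False)
    finally show ?thesis
      using False by simp
  qed
  note orth = this
  have "(\<Sum>z\<in>roots_of_minus_one k. (\<Sum>i<2 ^ k. of_int (r i) * z ^ i) * inverse z ^ j)
      = (\<Sum>i<2 ^ k. of_int (r i) * (\<Sum>z\<in>roots_of_minus_one k. z ^ i * inverse z ^ j))"
    unfolding sum_distrib_right sum_distrib_left
    by (subst sum.swap) (simp add: mult.assoc)
  also have "\<dots> = (\<Sum>i<2 ^ k. of_int (r i) * (if i = j then 2 ^ k else 0))"
    by (intro sum.cong) (simp_all add: orth)
  also have "\<dots> = 2 ^ k * of_int (r j)"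
    using assms by (simp add: if_distrib sum.delta cong: if_cong)
  finally show ?thesis .
qed

lemma sum_int_eval_roots_divisible:
  obtains s :: int where "(\<Sum>z\<in>roots_of_minus_one k. int_eval P z) = 2 ^ k * of_int s"
proof -
  obtain r where r: "\<And>z :: complex. z ^ 2 ^ k = -1 \<Longrightarrow> int_eval P z = (\<Sum>j<2 ^ k. of_int (r j) * z ^ j)"
    using int_eval_reduce[of "2 ^ k" P] by auto
  have "(\<Sum>z\<in>roots_of_minus_one k. int_eval P z) = 2 ^ k * of_int (r 0)"
    using sum_reduced_times_inverse_power[of 0 k r] by (simp add: r)
  then show thesis by (rule that)
qed

section \<open>Embeddings and the trace of a cyclotomic field\<close>

lemma complex_ring_simps [simp]:
  "carrier complex_ring = UNIV"
  "x \<otimes>\<^bsub>complex_ring\<^esub> y = x * y"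
  "\<one>\<^bsub>complex_ring\<^esub> = 1"
  "\<zero>\<^bsub>complex_ring\<^esub> = 0"
  "x \<oplus>\<^bsub>complex_ring\<^esub> y = x + y"
  by (simp_all add: ring_of_type_algebra_def)

lemma complex_ring_a_inv [simp]: "\<ominus>\<^bsub>complex_ring\<^esub> x = - x"
proof -
  interpret field complex_ring by (rule field_from_type_algebra)
  show ?thesis
    using minus_equality[of "- x" x] by simp
qed

lemma complex_ring_m_inv: "x \<noteq> 0 \<Longrightarrow> inv\<^bsub>complex_ring\<^esub> x = inverse x"
proof -
  assume "x \<noteq> 0"
  interpret field complex_ring by (rule field_from_type_algebra)
  show ?thesis
    using \<open>x \<noteq> 0\<close> by (intro comm_inv_char) simp_all
qed

lemma generate_ring_singleton: "generate_ring complex_ring {a} = range (\<lambda>P. int_eval P a)"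
proof (intro equalityI subsetI)
  fix x assume "x \<in> generate_ring complex_ring {a}"
  then show "x \<in> range (\<lambda>P. int_eval P a)"
  proof induction
    case one
    show ?case by (rule range_eqI[of _ _ 1]) simp
  next
    case (incl h)
    then show ?case by (intro range_eqI[of _ _ "[:0, 1:]"]) simp
  next
    case (a_inv h)
    then obtain P where "h = int_eval P a" by blast
    then show ?case by (intro range_eqI[of _ _ "- P"]) simp
  next
    case (eng_add h1 h2)
    then obtain P Q where "h1 = int_eval P a" "h2 = int_eval Q a" by blast
    then show ?case by (intro range_eqI[of _ _ "P + Q"]) simp
  next
    case (eng_mult h1 h2)
    then obtain P Q where "h1 = int_eval P a" "h2 = int_eval Q a" by blast
    then show ?case by (intro range_eqI[of _ _ "P * Q"]) simp
  qed
next
  note closed = generate_ring.intros[where R = complex_ring, simplified]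
  have int: "of_int c \<in> generate_ring complex_ring {a}" for c
  proof (induction c rule: int_induct[of _ 0])
    case base
    show ?case using closed(4)[OF closed(1) closed(3)[OF closed(1)]] by simp
  next
    case (step1 i)
    then show ?case using closed(4)[OF step1(2) closed(1)] by simp
  next
    case (step2 i)
    then show ?case using closed(4)[OF step2(2) closed(3)[OF closed(1)]] by simp
  qed
  have "int_eval P a \<in> generate_ring complex_ring {a}" for P
  proof (induction P)
    case 0
    show ?case using int[of 0] by simp
  next
    case (pCons c P)
    then show ?case
      using closed(4)[OF int[of c] closed(5)[OF closed(2)[of a] pCons(2)]] by simp
  qed
  then show "x \<in> generate_ring complex_ring {a}" if "x \<in> range (\<lambda>P. int_eval P a)" for x
    using that by blast
qed

lemma generate_ring_subset_generate_field:
  "generate_ring R H \<subseteq> generate_field R H"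
proof
  fix x assume "x \<in> generate_ring R H"
  then show "x \<in> generate_field R H"
    by induction (auto intro: generate_field.intros)
qed

lemma int_eval_in_generate_field: "int_eval P a \<in> generate_field complex_ring {a}"
  by (rule subsetD[OF generate_ring_subset_generate_field]) (simp add: generate_ring_singleton)

text \<open>Quotients are allowed here in place of polynomials with rational coefficients, so that closure under
  inverses is evident.\<close>

lemma generate_field_singleton:
  "generate_field complex_ring {a} = {int_eval P a / int_eval Q a |P Q. int_eval Q a \<noteq> 0}"
    (is "_ = ?F")
proof (intro equalityI subsetI)
  have F_I: "int_eval P a / int_eval Q a \<in> ?F" if "int_eval Q a \<noteq> 0" for P Q
    using that by blast
  fix x assume "x \<in> generate_field complex_ring {a}"
  then show "x \<in> ?F"
  proof induction
    case one
    show ?case using F_I[of 1 1] by simp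
  next
    case (incl h)
    then show ?case using F_I[of 1 "[:0, 1:]"] by simp
  next
    case (a_inv h)
    then obtain P Q where "h = int_eval P a / int_eval Q a" "int_eval Q a \<noteq> 0" by blast
    then show ?case using F_I[of Q "- P"] by simp
  next
    case (m_inv h)
    then obtain P Q where "h = int_eval P a / int_eval Q a" "int_eval Q a \<noteq> 0" by blast
    then show ?case using F_I[of P Q] m_inv(2) by (simp add: complex_ring_m_inv)
  next
    case (eng_add h1 h2)
    then obtain P Q P' Q' where "h1 = int_eval P a / int_eval Q a" "int_eval Q a \<noteq> 0"
      "h2 = int_eval P' a / int_eval Q' a" "int_eval Q' a \<noteq> 0" by blast
    then show ?case using F_I[of "Q * Q'" "P * Q' + P' * Q"] by (simp add: add_frac_eq)
  next
    case (eng_mult h1 h2)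
    then obtain P Q P' Q' where "h1 = int_eval P a / int_eval Q a" "int_eval Q a \<noteq> 0"
      "h2 = int_eval P' a / int_eval Q' a" "int_eval Q' a \<noteq> 0" by blast
    then show ?case using F_I[of "Q * Q'" "P * P'"] by simp
  qed
next
  fix x assume "x \<in> ?F"
  then obtain P Q where x: "x = int_eval P a / int_eval Q a" "int_eval Q a \<noteq> 0" by blast
  have mem: "int_eval R a \<in> generate_field complex_ring {a}" for R
    by (rule int_eval_in_generate_field)
  show "x \<in> generate_field complex_ring {a}"
    using generate_field.eng_mult[OF mem[of P] generate_field.m_inv[OF mem[of Q]]] x
    by (simp add: complex_ring_m_inv divide_inverse)
qed

lemma embedding_simps:
  assumes "\<sigma> \<in> embeddings L"
  shows "\<sigma> 1 = 1" "x \<in> L \<Longrightarrow> y \<in> L \<Longrightarrow> \<sigma> (x + y) = \<sigma> x + \<sigma> y"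
    "x \<in> L \<Longrightarrow> y \<in> L \<Longrightarrow> \<sigma> (x * y) = \<sigma> x * \<sigma> y"
  using assms by (auto simp: embeddings_def ring_hom_def)

lemma embedding_int_eval:
  assumes \<sigma>: "\<sigma> \<in> embeddings (generate_field complex_ring {a})"
  shows "\<sigma> (int_eval P a) = int_eval P (\<sigma> a)"
proof -
  let ?L = "generate_field complex_ring {a}"
  have mem: "int_eval R a \<in> ?L" for R
    by (rule int_eval_in_generate_field)
  have zero: "\<sigma> 0 = 0"
    using embedding_simps(2)[OF \<sigma> mem[of 0] mem[of 0]] by simp
  have int_mem: "of_int c \<in> ?L" for c
    using mem[of "[:c:]"] by simp
  have int: "\<sigma> (of_int c) = of_int c" for c
  proof (induction c rule: int_induct[of _ 0])
    case base
    show ?case by (simp add: zero)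
  next
    case (step1 i)
    then show ?case
      using embedding_simps(2)[OF \<sigma> int_mem[of i] int_mem[of 1]] by (simp add: embedding_simps(1)[OF \<sigma>])
  next
    case (step2 i)
    then show ?case
      using embedding_simps(2)[OF \<sigma> int_mem[of "i - 1"] int_mem[of 1]]
      by (simp add: embedding_simps(1)[OF \<sigma>] eq_diff_eq)
  qed
  have a: "a \<in> ?L"
    by (rule generate_field.incl) simp
  show ?thesis
  proof (induction P)
    case 0
    show ?case by (simp add: zero)
  next
    case (pCons c P)
    then show ?case
      using embedding_simps(2)[OF \<sigma> int_mem[of c] mem[of "[:0, 1:] * P"]]
      by (simp add: int embedding_simps(3)[OF \<sigma> a mem])
  qed
qed

lemma embedding_quotient:
  assumes "\<sigma> \<in> embeddings (generate_field complex_ring {a})" and "int_eval Q a \<noteq> 0"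
  shows "\<sigma> (int_eval P a / int_eval Q a) = int_eval P (\<sigma> a) / int_eval Q (\<sigma> a)"
    and "int_eval Q (\<sigma> a) \<noteq> 0"
proof -
  let ?L = "generate_field complex_ring {a}"
  have mem: "int_eval R a / int_eval Q a \<in> ?L" for R
    using assms(2) by (auto simp: generate_field_singleton)
  have Q: "int_eval Q a \<in> ?L"
    by (rule int_eval_in_generate_field)
  have *: "\<sigma> (int_eval R a / int_eval Q a) * int_eval Q (\<sigma> a) = int_eval R (\<sigma> a)" for R
    using embedding_simps(3)[OF assms(1) mem[of R] Q] assms(2)
    by (simp add: embedding_int_eval[OF assms(1)])
  show "int_eval Q (\<sigma> a) \<noteq> 0"
    using *[of 1] by auto
  then show "\<sigma> (int_eval P a / int_eval Q a) = int_eval P (\<sigma> a) / int_eval Q (\<sigma> a)"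
    using *[of P] by (simp add: field_simps)
qed

text \<open>Every root \<open>w\<close> extends to the embedding \<open>P(a) / Q(a) \<mapsto> P(w) / Q(w)\<close>. It is well defined since an integer
  polynomial vanishes at \<open>a\<close> if and only if it vanishes at \<open>w\<close>.\<close>

lemma embeddings_bij_roots:
  assumes a: "a \<in> roots_of_minus_one k"
  shows "bij_betw (\<lambda>\<sigma>. \<sigma> a) (embeddings (generate_field complex_ring {a})) (roots_of_minus_one k)"
proof (rule bij_betwI')
  let ?L = "generate_field complex_ring {a}"
  fix \<sigma> \<tau> assume \<sigma>: "\<sigma> \<in> embeddings ?L" and \<tau>: "\<tau> \<in> embeddings ?L"
  show "\<sigma> a = \<tau> a \<longleftrightarrow> \<sigma> = \<tau>"
  proof
    assume eq: "\<sigma> a = \<tau> a"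
    show "\<sigma> = \<tau>"
    proof (rule extensionalityI[of _ ?L])
      fix x assume "x \<in> ?L"
      then show "\<sigma> x = \<tau> x"
        using embedding_quotient[OF \<sigma>] embedding_quotient[OF \<tau>] eq
        by (auto simp: generate_field_singleton)
    qed (use \<sigma> \<tau> in \<open>simp_all add: embeddings_def\<close>)
  qed simp
next
  let ?L = "generate_field complex_ring {a}"
  fix \<sigma> assume \<sigma>: "\<sigma> \<in> embeddings ?L"
  have "int_eval (monom 1 (2 ^ k) + 1) a = 0"
    using a by simp
  then have "int_eval (monom 1 (2 ^ k) + 1) (\<sigma> a) = 0"
    using embedding_int_eval[OF \<sigma>, of 0] embedding_int_eval[OF \<sigma>] by (metis int_eval_0)
  then show "\<sigma> a \<in> roots_of_minus_one k"
    by (simp add: eq_neg_iff_add_eq_0)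
next
  let ?L = "generate_field complex_ring {a}"
  fix w assume w: "w \<in> roots_of_minus_one k"
  have transfer: "int_eval P a = 0 \<longleftrightarrow> int_eval P w = 0" for P
    using int_eval_zero_transfer[of a k w P] int_eval_zero_transfer[of w k a P] a w by blast
  have "\<exists>P Q. int_eval Q a \<noteq> 0 \<and> x = int_eval P a / int_eval Q a" if "x \<in> ?L" for x
    using that by (auto simp: generate_field_singleton)
  then obtain num den where nd: "int_eval (den x) a \<noteq> 0" "x = int_eval (num x) a / int_eval (den x) a"
    if "x \<in> ?L" for x
    by metis
  define \<sigma> where "\<sigma> = (\<lambda>x\<in>?L. int_eval (num x) w / int_eval (den x) w)"
  have \<sigma>: "\<sigma> (int_eval P a / int_eval Q a) = int_eval P w / int_eval Q w"
    if Q: "int_eval Q a \<noteq> 0" for P Q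
  proof -
    define x where "x = int_eval P a / int_eval Q a"
    have x: "x \<in> ?L"
      using Q by (auto simp: generate_field_singleton x_def)
    have "int_eval (num x * Q - P * den x) a = 0"
      using nd[OF x] Q by (simp add: x_def field_simps)
    then have "int_eval (num x * Q - P * den x) w = 0"
      by (simp only: transfer)
    moreover have "int_eval (den x) w \<noteq> 0" "int_eval Q w \<noteq> 0"
      using nd(1)[OF x] Q transfer by blast+
    ultimately have "int_eval (num x) w / int_eval (den x) w = int_eval P w / int_eval Q w"
      by (simp add: field_simps)
    then show ?thesis
      using x by (simp add: \<sigma>_def x_def)
  qed
  have "\<sigma> \<in> ring_hom (complex_subring ?L) complex_ring"
  proof (rule ring_hom_memI)
    fix x y assume "x \<in> carrier (complex_subring ?L)" "y \<in> carrier (complex_subring ?L)"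
    then obtain P Q P' Q' where x: "x = int_eval P a / int_eval Q a" and Q: "int_eval Q a \<noteq> 0"
      and y: "y = int_eval P' a / int_eval Q' a" and Q': "int_eval Q' a \<noteq> 0"
      by (auto simp: generate_field_singleton)
    have QQ': "int_eval (Q * Q') a \<noteq> 0" "int_eval Q w \<noteq> 0" "int_eval Q' w \<noteq> 0"
      using Q Q' transfer by auto
    show "\<sigma> (x \<otimes>\<^bsub>complex_subring ?L\<^esub> y) = \<sigma> x \<otimes>\<^bsub>complex_ring\<^esub> \<sigma> y"
      using \<sigma>[OF QQ'(1), of "P * P'"] \<sigma>[OF Q, of P] \<sigma>[OF Q', of P'] by (simp add: x y)
    show "\<sigma> (x \<oplus>\<^bsub>complex_subring ?L\<^esub> y) = \<sigma> x \<oplus>\<^bsub>complex_ring\<^esub> \<sigma> y"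
      using \<sigma>[OF QQ'(1), of "P * Q' + P' * Q"] \<sigma>[OF Q, of P] \<sigma>[OF Q', of P'] QQ' Q Q'
      by (simp add: x y add_frac_eq)
  qed (use \<sigma>[of 1 1] in simp_all)
  then have "\<sigma> \<in> embeddings ?L"
    by (simp add: embeddings_def \<sigma>_def)
  moreover have "w = \<sigma> a"
    using \<sigma>[of 1 "[:0, 1:]"] by simp
  ultimately show "\<exists>\<sigma>\<in>embeddings ?L. w = \<sigma> a" by blast
qed

lemma field_trace_int_eval:
  assumes "a \<in> roots_of_minus_one k"
  shows "field_trace (generate_field complex_ring {a}) (int_eval P a)
       = (\<Sum>z\<in>roots_of_minus_one k. int_eval P z)"
  unfolding field_trace_def
  by (subst sum.reindex_bij_betw[OF embeddings_bij_roots[OF assms], symmetric])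
     (simp add: embedding_int_eval)

section \<open>Integers in the cyclotomic field and in its real subfield\<close>

lemma zeta_in_roots_of_minus_one:
  assumes "n \<ge> 1"
  shows "zeta n \<in> roots_of_minus_one (n - 1)"
proof -
  obtain m where n: "n = Suc m"
    using assms by (cases n) auto
  have "zeta n ^ 2 ^ m = exp (of_nat (2 ^ m) * (2 * complex_of_real pi * \<i> / 2 ^ n))"
    unfolding zeta_def by (rule exp_of_nat_mult[symmetric])
  also have "of_nat (2 ^ m) * (2 * complex_of_real pi * \<i> / 2 ^ n) = complex_of_real pi * \<i>"
    by (simp add: n)
  finally show ?thesis
    by (simp add: n)
qed

lemma zeta_nonzero [simp]: "zeta n \<noteq> 0"
  by (simp add: zeta_def)

lemma cnj_zeta: "cnj (zeta n) = inverse (zeta n)"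
proof -
  have "zeta n = cis (2 * pi / 2 ^ n)"
    by (simp add: zeta_def cis_conv_exp mult_ac)
  then show ?thesis
    by (simp add: cis_cnj cis_inverse)
qed

lemma carrier_cyclo_int: "carrier (cyclo_int n) = range (\<lambda>P. int_eval P (zeta n))"
  by (simp add: cyclo_int_def generate_ring_singleton)

lemma carrier_real_cyclo_int:
  "carrier (real_cyclo_int n) = range (\<lambda>P. int_eval P (zeta n + inverse (zeta n)))"
  by (simp add: real_cyclo_int_def generate_ring_singleton)

lemma inverse_zeta_power:
  assumes "n \<ge> 1"
  shows "inverse (zeta n) ^ j = zeta n ^ ((2 ^ n - 1) * j)"
  using inverse_power_root_of_minus_one[OF zeta_in_roots_of_minus_one[OF assms], of j] assms
  by simp

lemma real_cyclo_int_subset: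
  assumes "n \<ge> 1"
  shows "carrier (real_cyclo_int n) \<subseteq> carrier (cyclo_int n)"
proof
  fix y assume "y \<in> carrier (real_cyclo_int n)"
  then obtain P where "y = int_eval P (zeta n + inverse (zeta n))"
    by (auto simp: carrier_real_cyclo_int)
  then have "y = int_eval (pcompose P ([:0, 1:] + monom 1 (2 ^ n - 1))) (zeta n)"
    using inverse_zeta_power[OF assms, of 1] by simp
  then show "y \<in> carrier (cyclo_int n)"
    unfolding carrier_cyclo_int by blast
qed

lemma cnj_int_eval: "cnj (int_eval P z) = int_eval P (cnj z)"
  by (induction P) simp_all

lemma cnj_real_cyclo_int:
  assumes "y \<in> carrier (real_cyclo_int n)"
  shows "cnj y = y"
  using assms by (auto simp: carrier_real_cyclo_int cnj_int_eval cnj_zeta add.commute)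

section \<open>The coefficients of \<open>u(\<beta>)\<close>\<close>

text \<open>The coefficient formula in terms of a polynomial that represents \<open>\<beta>\<close>, with the trace written as a sum over
  roots and the index read modulo \<open>2 ^ n\<close>; \<open>of_bool (2 ^ n dvd j)\<close> is the coefficient of the group identity.\<close>

definition u_poly_coeff :: "nat \<Rightarrow> int poly \<Rightarrow> nat \<Rightarrow> complex" where
  "u_poly_coeff n P j = of_bool (2 ^ n dvd j)
     + (\<Sum>z\<in>roots_of_minus_one (n - 1). (int_eval P z - 1) * inverse z ^ j) / 2 ^ n"

lemma u_coeff_conv_u_poly_coeff:
  assumes "n \<ge> 1" and "j < 2 ^ n"
  shows "u_coeff n (int_eval P (zeta n)) j = u_poly_coeff n P j"
proof -
  let ?Q = "(P - 1) * monom 1 ((2 ^ n - 1) * j)"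
  have trace: "field_trace (cyclo_field n) ((int_eval P (zeta n) - 1) * inverse (zeta n) ^ j)
      = (\<Sum>z\<in>roots_of_minus_one (n - 1). (int_eval P z - 1) * inverse z ^ j)"
  proof -
    have "field_trace (cyclo_field n) ((int_eval P (zeta n) - 1) * inverse (zeta n) ^ j)
        = field_trace (cyclo_field n) (int_eval ?Q (zeta n))"
      by (simp add: inverse_zeta_power[OF assms(1)])
    also have "\<dots> = (\<Sum>z\<in>roots_of_minus_one (n - 1). int_eval ?Q z)"
      unfolding cyclo_field_def
      by (rule field_trace_int_eval[OF zeta_in_roots_of_minus_one[OF assms(1)]])
    also have "\<dots> = (\<Sum>z\<in>roots_of_minus_one (n - 1). (int_eval P z - 1) * inverse z ^ j)"
      by (intro sum.cong refl) (use assms(1) in \<open>simp add: inverse_power_root_of_minus_one\<close>)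
    finally show ?thesis .
  qed
  have "2 ^ n dvd j \<longleftrightarrow> j = 0"
    using assms(2) by (auto dest: dvd_imp_le)
  then show ?thesis
    using trace by (auto simp: u_coeff_def u_poly_coeff_def)
qed

lemma root_of_minus_one_order:
  assumes "n \<ge> 1" and "z \<in> roots_of_minus_one (n - 1)"
  shows "z ^ 2 ^ n = 1" and "z \<noteq> 0"
proof -
  show "z ^ 2 ^ n = 1"
    using roots_of_minus_one_power_order[of z "n - 1"] assms by simp
  then show "z \<noteq> 0"
    by (auto simp: power_0_left)
qed

lemma u_poly_coeff_periodic:
  assumes "n \<ge> 1"
  shows "u_poly_coeff n P (j mod 2 ^ n) = u_poly_coeff n P j"
proof -
  have "inverse z ^ (j mod 2 ^ n) = inverse z ^ j" if "z \<in> roots_of_minus_one (n - 1)" for z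
  proof -
    have "inverse z ^ j = inverse z ^ (2 ^ n * (j div 2 ^ n) + j mod 2 ^ n)"
      by simp
    also have "\<dots> = (inverse z ^ 2 ^ n) ^ (j div 2 ^ n) * inverse z ^ (j mod 2 ^ n)"
      by (simp only: power_add power_mult)
    also have "inverse z ^ 2 ^ n = 1"
      using root_of_minus_one_order[OF assms that] by (simp add: power_inverse)
    finally show ?thesis by simp
  qed
  then show ?thesis
    by (simp add: u_poly_coeff_def dvd_mod_iff)
qed

text \<open>If \<open>\<beta> - 1 = \<Sum>j<2 ^ (n - 1). r j * zeta n ^ j\<close>, then trace duality shows that the coefficient with
  index \<open>j < 2 ^ (n - 1)\<close> is \<open>r j / 2\<close>, up to the integer contributed by the group identity. So the coefficients
  are integers exactly if all \<open>r j\<close> are even.\<close>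

lemma u_coeff_integral_iff:
  assumes n: "n \<ge> 1" and \<beta>: "\<beta> \<in> carrier (cyclo_int n)"
  shows "(\<forall>j<2 ^ n. u_coeff n \<beta> j \<in> \<int>) \<longleftrightarrow> cong_two n \<beta> 1"
proof
  let ?k = "n - 1"
  have pow: "(2::nat) ^ n = 2 ^ ?k + 2 ^ ?k" "(2::complex) ^ n = 2 * 2 ^ ?k"
    using n by (cases n; simp)+
  assume integral: "\<forall>j<2 ^ n. u_coeff n \<beta> j \<in> \<int>"
  obtain P where P: "\<beta> = int_eval P (zeta n)"
    using \<beta> by (auto simp: carrier_cyclo_int)
  obtain r where r: "\<And>z :: complex. z ^ 2 ^ ?k = -1 \<Longrightarrow>
      int_eval (P - 1) z = (\<Sum>j<2 ^ ?k. of_int (r j) * z ^ j)"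
    using int_eval_reduce[of "2 ^ ?k" "P - 1"] by auto
  have even: "even (r j)" if "j < 2 ^ ?k" for j
  proof -
    have "u_coeff n \<beta> j \<in> \<int>"
      using integral that pow(1) by simp
    moreover have "u_coeff n \<beta> j = of_bool (2 ^ n dvd j) + of_int (r j) / 2"
    proof -
      have "u_coeff n \<beta> j = of_bool (2 ^ n dvd j) +
          (\<Sum>z\<in>roots_of_minus_one ?k. (int_eval P z - 1) * inverse z ^ j) / 2 ^ n"
        unfolding P by (subst u_coeff_conv_u_poly_coeff[OF n]) (use that pow(1) in \<open>simp_all add: u_poly_coeff_def\<close>)
      also have "(\<Sum>z\<in>roots_of_minus_one ?k. (int_eval P z - 1) * inverse z ^ j)
          = (\<Sum>z\<in>roots_of_minus_one ?k. (\<Sum>i<2 ^ ?k. of_int (r i) * z ^ i) * inverse z ^ j)"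
        using r by (intro sum.cong refl) simp
      also have "\<dots> = 2 ^ ?k * of_int (r j)"
        by (rule sum_reduced_times_inverse_power[OF that])
      finally show ?thesis
        by (simp add: pow(2))
    qed
    ultimately have "(of_int (r j) / 2 :: complex) \<in> \<int>"
      using Ints_diff[of "u_coeff n \<beta> j" "of_bool (2 ^ n dvd j)"] by (simp add: of_bool_def split: if_splits)
    then obtain c where "(of_int (r j) / 2 :: complex) = of_int c"
      by (rule Ints_cases)
    then have "(of_int (r j) :: complex) = of_int (2 * c)"
      by (simp add: field_simps)
    then show ?thesis
      by (simp only: of_int_eq_iff) simp
  qed
  define S where "S = (\<Sum>j<2 ^ ?k. monom (r j div 2) j)"
  have "\<beta> - 1 = (\<Sum>j<2 ^ ?k. of_int (r j) * zeta n ^ j)"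
    using r[of "zeta n"] zeta_in_roots_of_minus_one[OF n] by (simp add: P)
  also have "\<dots> = 2 * int_eval S (zeta n)"
    unfolding S_def int_eval_sum sum_distrib_left
  proof (intro sum.cong refl)
    fix j assume "j \<in> {..<(2::nat) ^ ?k}"
    then obtain c where c: "r j = 2 * c"
      using even by auto
    show "of_int (r j) * zeta n ^ j = 2 * int_eval (monom (r j div 2) j) (zeta n)"
      by (simp add: c)
  qed
  finally show "cong_two n \<beta> 1"
    by (auto simp: cong_two_def carrier_cyclo_int)
next
  let ?k = "n - 1"
  have pow: "(2::complex) ^ n = 2 * 2 ^ ?k"
    using n by (cases n; simp)+
  assume "cong_two n \<beta> 1"
  then obtain S where "\<beta> - 1 = 2 * int_eval S (zeta n)"
    by (auto simp: cong_two_def carrier_cyclo_int)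
  then have \<beta>: "\<beta> = int_eval (1 + 2 * S) (zeta n)"
    by (simp add: eq_diff_eq algebra_simps)
  show "\<forall>j<2 ^ n. u_coeff n \<beta> j \<in> \<int>"
  proof (intro allI impI)
    fix j :: nat assume j: "j < 2 ^ n"
    obtain s :: int where s: "(\<Sum>z\<in>roots_of_minus_one ?k. int_eval (S * monom 1 ((2 ^ n - 1) * j)) z)
        = 2 ^ ?k * of_int s"
      using sum_int_eval_roots_divisible by blast
    have "(\<Sum>z\<in>roots_of_minus_one ?k. (int_eval (1 + 2 * S) z - 1) * inverse z ^ j)
        = 2 * (\<Sum>z\<in>roots_of_minus_one ?k. int_eval (S * monom 1 ((2 ^ n - 1) * j)) z)"
      unfolding sum_distrib_left
      by (intro sum.cong refl) (use n in \<open>simp add: inverse_power_root_of_minus_one\<close>)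
    then have "u_coeff n \<beta> j = of_bool (2 ^ n dvd j) + of_int s"
      unfolding \<beta> u_coeff_conv_u_poly_coeff[OF n j] u_poly_coeff_def pow s by simp
    then show "u_coeff n \<beta> j \<in> \<int>"
      by simp
  qed
qed

section \<open>Orthogonality and multiplicativity\<close>

lemma sum_powers_root_of_unity:
  fixes q :: "'a :: field"
  assumes "q ^ M = 1"
  shows "(\<Sum>i<M. q ^ i) = (if q = 1 then of_nat M else 0)"
  using assms by (simp add: sum_gp_strict)

text \<open>The trivial character does not occur among the characters \<open>x \<mapsto> z\<close> for roots \<open>z\<close> of \<open>X ^ 2 ^ (n - 1) + 1\<close>, so
  \<open>u(\<beta>)\<close> and \<open>1\<close> have the same augmentation.\<close>

lemma sum_u_poly_coeff:
  assumes "n \<ge> 1"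
  shows "(\<Sum>j<2 ^ n. u_poly_coeff n P j) = 1"
proof -
  have "(\<Sum>j<(2::nat) ^ n. of_bool (2 ^ n dvd j) :: complex) = (\<Sum>j<(2::nat) ^ n. if j = 0 then 1 else 0)"
    by (intro sum.cong) (auto dest: dvd_imp_le)
  then have delta: "(\<Sum>j<(2::nat) ^ n. of_bool (2 ^ n dvd j) :: complex) = 1"
    by (simp add: sum.delta')
  have "(\<Sum>j<2 ^ n. inverse z ^ j) = 0" if "z \<in> roots_of_minus_one (n - 1)" for z
  proof -
    have "z \<noteq> 1"
      using that by auto
    then show ?thesis
      using root_of_minus_one_order[OF assms that]
      by (subst sum_powers_root_of_unity) (simp_all add: power_inverse)
  qed
  then have "(\<Sum>j<2 ^ n. \<Sum>z\<in>roots_of_minus_one (n - 1). (int_eval P z - 1) * inverse z ^ j) = 0"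
    by (subst sum.swap) (simp flip: sum_distrib_left)
  then show ?thesis
    by (simp add: u_poly_coeff_def sum.distrib delta flip: sum_divide_distrib)
qed

text \<open>Multiplicativity of \<open>u\<close>. The element \<open>u(\<beta>) - 1\<close> is the combination of the primitive idempotents belonging to the
  roots \<open>z\<close>, with coefficients \<open>P(z) - 1\<close>. The orthogonality relation \<open>orth\<close> says that these idempotents are
  orthogonal, and the rest is \<open>(p - 1) + (q - 1) + (p - 1) (q - 1) = p q - 1\<close>.\<close>

lemma u_poly_coeff_convolution:
  assumes n: "n \<ge> 1" and j: "j < 2 ^ n"
  shows "(\<Sum>i<2 ^ n. u_poly_coeff n P i * u_poly_coeff n Q (j + (2 ^ n - i))) = u_poly_coeff n (P * Q) j"
proof -
  let ?R = "roots_of_minus_one (n - 1)"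
  define \<delta> :: "nat \<Rightarrow> complex" where "\<delta> i = of_bool (2 ^ n dvd i)" for i
  define c where "c P i = (\<Sum>z\<in>?R. (int_eval P z - 1) * inverse z ^ i) / 2 ^ n" for P i
  have u: "u_poly_coeff n P i = \<delta> i + c P i" for P i
    by (simp add: u_poly_coeff_def \<delta>_def c_def)
  have "(\<Sum>i<2 ^ n. \<delta> i * u_poly_coeff n Q (j + (2 ^ n - i)))
      = (\<Sum>i<(2::nat) ^ n. if i = 0 then u_poly_coeff n Q (j + 2 ^ n) else 0)"
    by (intro sum.cong refl) (auto simp: \<delta>_def dest: dvd_imp_le)
  also have "\<dots> = u_poly_coeff n Q j"
    using u_poly_coeff_periodic[OF n, of Q "j + 2 ^ n"] u_poly_coeff_periodic[OF n, of Q j]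
    by (simp add: sum.delta')
  finally have 1: "(\<Sum>i<2 ^ n. \<delta> i * u_poly_coeff n Q (j + (2 ^ n - i))) = \<delta> j + c Q j"
    by (simp add: u)
  have "2 ^ n dvd j + (2 ^ n - i) \<longleftrightarrow> i = j" if "i < 2 ^ n" for i
  proof
    assume "2 ^ n dvd j + (2 ^ n - i)"
    then have "int (2 ^ n) dvd int (j + (2 ^ n - i))"
      by (simp only: int_dvd_int_iff)
    also have "int (j + (2 ^ n - i)) = (int j - int i) + int (2 ^ n)"
      using that by (simp add: of_nat_diff)
    finally have "int (2 ^ n) dvd int j - int i"
      by (subst (asm) dvd_add_left_iff) simp_all
    moreover have "\<bar>int j - int i\<bar> < int (2 ^ n)"
      using that j by linarith
    ultimately show "i = j"
      using dvd_imp_le_int[of "int j - int i"] by fastforce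
  qed (use that in simp)
  then have "(\<Sum>i<2 ^ n. c P i * \<delta> (j + (2 ^ n - i))) = (\<Sum>i<(2::nat) ^ n. if i = j then c P j else 0)"
    by (intro sum.cong refl) (auto simp: \<delta>_def)
  then have 2: "(\<Sum>i<2 ^ n. c P i * \<delta> (j + (2 ^ n - i))) = c P j"
    using j by (simp add: sum.delta')
  \<comment> \<open>substituting \<open>inverse w ^ (2 ^ n - i) = w ^ i\<close> leaves a geometric sum in \<open>w / z\<close>\<close>
  have orth: "(\<Sum>i<2 ^ n. inverse z ^ i * inverse w ^ (j + (2 ^ n - i)))
      = (if w = z then 2 ^ n * inverse z ^ j else 0)"
    if z: "z \<in> ?R" and w: "w \<in> ?R" for z w
  proof -
    note zw = root_of_minus_one_order[OF n z] root_of_minus_one_order[OF n w]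
    have "inverse z ^ i * inverse w ^ (j + (2 ^ n - i)) = inverse w ^ j * (w / z) ^ i" if "i < 2 ^ n" for i
    proof -
      have "w ^ (2 ^ n - i) * w ^ i = 1"
        using that zw(3) by (simp flip: power_add)
      then have "inverse w ^ (2 ^ n - i) = w ^ i"
        unfolding power_inverse by (rule inverse_unique)
      then show ?thesis
        by (simp add: power_add divide_inverse power_mult_distrib)
    qed
    then have "(\<Sum>i<2 ^ n. inverse z ^ i * inverse w ^ (j + (2 ^ n - i)))
        = inverse w ^ j * (\<Sum>i<2 ^ n. (w / z) ^ i)"
      by (simp add: sum_distrib_left)
    also have "(\<Sum>i<2 ^ n. (w / z) ^ i) = (if w = z then 2 ^ n else 0)"
      using zw by (subst sum_powers_root_of_unity) (simp_all add: power_divide)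
    finally show ?thesis by simp
  qed
  have "(\<Sum>i<2 ^ n. c P i * c Q (j + (2 ^ n - i)))
      = (\<Sum>i<2 ^ n. \<Sum>z\<in>?R. \<Sum>w\<in>?R. (int_eval P z - 1) * (int_eval Q w - 1) *
          (inverse z ^ i * inverse w ^ (j + (2 ^ n - i))) / (2 ^ n * 2 ^ n))"
    unfolding c_def times_divide_times_eq sum_product sum_divide_distrib
    by (intro sum.cong refl) (simp only: mult_ac)
  also have "\<dots> = (\<Sum>z\<in>?R. \<Sum>w\<in>?R. \<Sum>i<2 ^ n. (int_eval P z - 1) * (int_eval Q w - 1) *
          (inverse z ^ i * inverse w ^ (j + (2 ^ n - i))) / (2 ^ n * 2 ^ n))"
    by (subst sum.swap, intro sum.cong refl, rule sum.swap)
  also have "\<dots> = (\<Sum>z\<in>?R. \<Sum>w\<in>?R. (int_eval P z - 1) * (int_eval Q w - 1) *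
          (\<Sum>i<2 ^ n. inverse z ^ i * inverse w ^ (j + (2 ^ n - i))) / (2 ^ n * 2 ^ n))"
    by (simp only: sum_distrib_left sum_divide_distrib)
  also have "\<dots> = (\<Sum>z\<in>?R. \<Sum>w\<in>?R. if w = z then
          (int_eval P z - 1) * (int_eval Q z - 1) * inverse z ^ j / 2 ^ n else 0)"
    by (intro sum.cong refl) (simp only: orth, simp)
  also have "\<dots> = (\<Sum>z\<in>?R. (int_eval P z - 1) * (int_eval Q z - 1) * inverse z ^ j) / 2 ^ n"
    by (simp add: sum.delta' sum_divide_distrib)
  finally have 3: "(\<Sum>i<2 ^ n. c P i * c Q (j + (2 ^ n - i)))
      = (\<Sum>z\<in>?R. (int_eval P z - 1) * (int_eval Q z - 1) * inverse z ^ j) / 2 ^ n" .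
  have "(\<Sum>i<2 ^ n. u_poly_coeff n P i * u_poly_coeff n Q (j + (2 ^ n - i)))
      = (\<Sum>i<2 ^ n. \<delta> i * u_poly_coeff n Q (j + (2 ^ n - i)))
        + (\<Sum>i<2 ^ n. c P i * \<delta> (j + (2 ^ n - i))) + (\<Sum>i<2 ^ n. c P i * c Q (j + (2 ^ n - i)))"
    by (simp add: u ring_distribs sum.distrib)
  also have "\<dots> = \<delta> j + (c Q j + c P j
      + (\<Sum>z\<in>?R. (int_eval P z - 1) * (int_eval Q z - 1) * inverse z ^ j) / 2 ^ n)"
    unfolding 1 2 3 by simp
  also have "c Q j + c P j
      + (\<Sum>z\<in>?R. (int_eval P z - 1) * (int_eval Q z - 1) * inverse z ^ j) / 2 ^ n = c (P * Q) j"
    unfolding c_def add_divide_distrib[symmetric] sum.distrib[symmetric]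
    by (rule arg_cong2[of _ _ _ _ "(/)"]; (intro sum.cong refl)?) (simp add: algebra_simps)
  finally show ?thesis
    by (simp add: u)
qed

section \<open>The group ring of a cyclic group over the integers\<close>

abbreviation int_ring :: "complex ring" where
  "int_ring \<equiv> complex_subring \<int>"

lemma finsum_int_ring:
  assumes "finite A" and "f \<in> A \<rightarrow> \<int>"
  shows "finsum int_ring f A = sum f A"
proof -
  interpret abelian_monoid int_ring
    by (rule abelian_monoidI) auto
  show ?thesis
    using assms by (induction A rule: finite_induct) auto
qed

lemma group_ring_int_mult:
  assumes "group G" and "finite (carrier G)" and "a \<in> carrier (group_ring int_ring G)"
    and "b \<in> carrier (group_ring int_ring G)" and g: "g \<in> carrier G"
  shows "(a \<otimes>\<^bsub>group_ring int_ring G\<^esub> b) g = (\<Sum>h\<in>carrier G. a h * b (inv\<^bsub>G\<^esub> h \<otimes>\<^bsub>G\<^esub> g))"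
proof -
  interpret group G by fact
  let ?S = "group_ring_supp int_ring G a"
  have "(a \<otimes>\<^bsub>group_ring int_ring G\<^esub> b) g = (\<Oplus>\<^bsub>int_ring\<^esub>h\<in>?S. a h * b (inv\<^bsub>G\<^esub> h \<otimes>\<^bsub>G\<^esub> g))"
    using g by (simp add: group_ring_def)
  also have "\<dots> = (\<Sum>h\<in>?S. a h * b (inv\<^bsub>G\<^esub> h \<otimes>\<^bsub>G\<^esub> g))"
    using assms by (intro finsum_int_ring) (auto simp: group_ring_def group_ring_supp_def intro!: Ints_mult)
  also have "\<dots> = (\<Sum>h\<in>carrier G. a h * b (inv\<^bsub>G\<^esub> h \<otimes>\<^bsub>G\<^esub> g))"
    using assms(2) by (intro sum.mono_neutral_left) (auto simp: group_ring_supp_def)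
  finally show ?thesis .
qed

lemma augmentation_int:
  assumes "finite (carrier G)" and "a \<in> carrier (group_ring int_ring G)"
  shows "augmentation int_ring G a = (\<Sum>g\<in>carrier G. a g)"
proof -
  have "augmentation int_ring G a = (\<Sum>g\<in>group_ring_supp int_ring G a. a g)"
    unfolding augmentation_def using assms
    by (intro finsum_int_ring) (auto simp: group_ring_def group_ring_supp_def)
  also have "\<dots> = (\<Sum>g\<in>carrier G. a g)"
    using assms(1) by (intro sum.mono_neutral_left) (auto simp: group_ring_supp_def)
  finally show ?thesis .
qed

lemma (in group) cyclic_power_bij:
  assumes x: "x \<in> carrier G" and "generate G {x} = carrier G" and "M > 0" and "Coset.order G = M"
  shows "bij_betw (\<lambda>j. x [^] j) {..<M} (carrier G)" and "x [^] M = \<one>"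
proof -
  have ord: "ord x = M"
    using generate_pow_card[OF x] assms by (simp add: Coset.order_def)
  show "x [^] M = \<one>"
    using pow_ord_eq_1[OF x] by (simp add: ord)
  have inj: "inj_on (\<lambda>j. x [^] j) {..<M}"
    using ord_inj[OF x] assms(3) by (simp add: ord atLeast0AtMost lessThan_Suc_atMost[symmetric])
  moreover have "finite (carrier G)"
    using assms(3,4) order_gt_0_iff_finite by simp
  ultimately have "(\<lambda>j. x [^] j) ` {..<M} = carrier G"
    using assms(4) x by (intro card_subset_eq) (auto simp: card_image Coset.order_def)
  with inj show "bij_betw (\<lambda>j. x [^] j) {..<M} (carrier G)"
    by (simp add: bij_betw_def)
qed

lemma u_elem_power:
  fixes G (structure)
  assumes "n \<ge> 1" and "group G" and "x \<in> carrier G" and "generate G {x} = carrier G" and "Coset.order G = 2 ^ n"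
  shows "u_elem n G x (int_eval P (zeta n)) (x [^]\<^bsub>G\<^esub> j) = u_poly_coeff n P j"
proof -
  interpret group G by fact
  note bij = cyclic_power_bij[OF assms(3,4) _ assms(5)]
  let ?r = "j mod 2 ^ n"
  have "x [^] j = (x [^] (2 ^ n :: nat)) [^] (j div 2 ^ n) \<otimes> x [^] ?r"
    using assms(3) by (simp add: nat_pow_pow nat_pow_mult)
  then have pow: "x [^] j = x [^] ?r"
    using bij assms(3) by simp
  have inj: "inj_on (\<lambda>i. x [^] i) {..<(2::nat) ^ n}"
    using bij(1) by (simp add: bij_betw_def)
  have "i = ?r" if "i < 2 ^ n" "x [^] i = x [^] j" for i
    using inj_onD[OF inj, of i ?r] that pow by simp
  then have "{i. i < 2 ^ n \<and> x [^] i = x [^] j} = {?r}"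
    using pow by (intro equalityI subsetI) simp_all
  then have "u_elem n G x (int_eval P (zeta n)) (x [^] j) = u_coeff n (int_eval P (zeta n)) ?r"
    using assms(3) unfolding u_elem_def by simp
  also have "\<dots> = u_poly_coeff n P ?r"
    by (rule u_coeff_conv_u_poly_coeff[OF assms(1)]) simp
  also have "\<dots> = u_poly_coeff n P j"
    by (rule u_poly_coeff_periodic[OF assms(1)])
  finally show ?thesis .
qed

lemma u_elem_in_group_ring_iff:
  fixes G (structure)
  assumes "n \<ge> 1" and "group G" and "x \<in> carrier G" and "generate G {x} = carrier G" and "Coset.order G = 2 ^ n"
    and "\<beta> \<in> carrier (cyclo_int n)"
  shows "u_elem n G x \<beta> \<in> carrier (group_ring int_ring G) \<longleftrightarrow> cong_two n \<beta> 1"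
proof -
  interpret group G by fact
  obtain P where P: "\<beta> = int_eval P (zeta n)"
    using assms(6) by (auto simp: carrier_cyclo_int)
  note bij = cyclic_power_bij[OF assms(3,4) _ assms(5)]
  have fin: "finite (carrier G)"
    using assms(5) order_gt_0_iff_finite by simp
  have "u_elem n G x \<beta> \<in> carrier (group_ring int_ring G) \<longleftrightarrow> (\<forall>g\<in>carrier G. u_elem n G x \<beta> g \<in> \<int>)"
    using fin by (auto simp: group_ring_def group_ring_supp_def u_elem_def)
  also have "carrier G = (\<lambda>j. x [^] j) ` {..<(2::nat) ^ n}"
    using bij(1) by (simp add: bij_betw_def)
  also have "(\<forall>g\<in>(\<lambda>j. x [^] j) ` {..<(2::nat) ^ n}. u_elem n G x \<beta> g \<in> \<int>)
      \<longleftrightarrow> (\<forall>j<2 ^ n. u_coeff n \<beta> j \<in> \<int>)"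
    by (auto simp: P u_elem_power[OF assms(1-5)] u_coeff_conv_u_poly_coeff[OF assms(1)])
  also have "\<dots> \<longleftrightarrow> cong_two n \<beta> 1"
    by (rule u_coeff_integral_iff[OF assms(1,6)])
  finally show ?thesis .
qed

lemma u_elem_mult_inverse:
  fixes G (structure)
  assumes "n \<ge> 1" and "group G" and "x \<in> carrier G" and "generate G {x} = carrier G" and "Coset.order G = 2 ^ n"
    and "\<beta> \<in> carrier (cyclo_int n)" and "\<gamma> \<in> carrier (cyclo_int n)" and "\<beta> * \<gamma> = 1"
    and "u_elem n G x \<beta> \<in> carrier (group_ring int_ring G)"
    and "u_elem n G x \<gamma> \<in> carrier (group_ring int_ring G)"
  shows "u_elem n G x \<beta> \<otimes>\<^bsub>group_ring int_ring G\<^esub> u_elem n G x \<gamma> = \<one>\<^bsub>group_ring int_ring G\<^esub>"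
proof -
  interpret group G by fact
  obtain P Q where P: "\<beta> = int_eval P (zeta n)" and Q: "\<gamma> = int_eval Q (zeta n)"
    using assms(6,7) by (auto simp: carrier_cyclo_int)
  note bij = cyclic_power_bij[OF assms(3,4) _ assms(5)]
  have fin: "finite (carrier G)"
    using assms(5) order_gt_0_iff_finite by simp
  have one: "u_poly_coeff n (P * Q) j = of_bool (2 ^ n dvd j)" for j
  proof -
    have "int_eval (P * Q - 1) z = 0" if "z \<in> roots_of_minus_one (n - 1)" for z
      using int_eval_zero_transfer[of "zeta n" "n - 1" z "P * Q - 1"] that
        zeta_in_roots_of_minus_one[OF assms(1)] assms(8) by (simp add: P Q)
    then show ?thesis
      by (simp add: u_poly_coeff_def)
  qed
  show ?thesis
  proof (rule extensionalityI[of _ "carrier G"])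
    fix g assume g: "g \<in> carrier G"
    then obtain j :: nat where j: "j < 2 ^ n" "g = x [^] j"
      using bij(1) by (auto simp: bij_betw_def)
    have "(u_elem n G x \<beta> \<otimes>\<^bsub>group_ring int_ring G\<^esub> u_elem n G x \<gamma>) g
        = (\<Sum>h\<in>carrier G. u_elem n G x \<beta> h * u_elem n G x \<gamma> (inv h \<otimes> g))"
      by (rule group_ring_int_mult[OF assms(2) fin assms(9,10) g])
    also have "\<dots> = (\<Sum>i<(2::nat) ^ n. u_elem n G x \<beta> (x [^] i) * u_elem n G x \<gamma> (inv (x [^] i) \<otimes> g))"
      by (rule sum.reindex_bij_betw[symmetric]) (use bij(1) in simp)
    also have "\<dots> = (\<Sum>i<2 ^ n. u_poly_coeff n P i * u_poly_coeff n Q (j + (2 ^ n - i)))"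
    proof (intro sum.cong refl)
      fix i assume i: "i \<in> {..<(2::nat) ^ n}"
      have "x [^] (2 ^ n - i) \<otimes> x [^] i = \<one>"
        using i assms(3) bij(2) by (simp add: nat_pow_mult)
      then have "inv (x [^] i) = x [^] (2 ^ n - i)"
        using assms(3) by (intro inv_equality) auto
      then have "inv (x [^] i) \<otimes> g = x [^] (j + (2 ^ n - i))"
        using assms(3) by (simp add: j nat_pow_mult add.commute)
      then show "u_elem n G x \<beta> (x [^] i) * u_elem n G x \<gamma> (inv (x [^] i) \<otimes> g)
          = u_poly_coeff n P i * u_poly_coeff n Q (j + (2 ^ n - i))"
        by (simp add: P Q u_elem_power[OF assms(1-5)])
    qed
    also have "\<dots> = of_bool (2 ^ n dvd j)"
      by (simp only: u_poly_coeff_convolution[OF assms(1) j(1)] one)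
    also have "2 ^ n dvd j \<longleftrightarrow> g = \<one>"
      using pow_eq_id[OF assms(3), of j] generate_pow_card[OF assms(3)] assms(4,5) j
      by (simp add: Coset.order_def)
    finally show "(u_elem n G x \<beta> \<otimes>\<^bsub>group_ring int_ring G\<^esub> u_elem n G x \<gamma>) g = \<one>\<^bsub>group_ring int_ring G\<^esub> g"
      using g by (simp add: group_ring_def)
  qed (simp_all add: group_ring_def)
qed

lemma Units_complex_subring:
  "Units (complex_subring S) = {y \<in> S. \<exists>z\<in>S. y * z = 1}"
  by (auto simp: Units_def mult.commute)

lemma cong_two_inverse:
  assumes "\<beta> * \<gamma> = 1" and "\<gamma> \<in> carrier (cyclo_int n)" and "cong_two n \<beta> 1"
  shows "cong_two n \<gamma> 1"
proof -
  obtain S Q where S: "\<beta> - 1 = 2 * int_eval S (zeta n)" and Q: "\<gamma> = int_eval Q (zeta n)"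
    using assms(2,3) by (auto simp: cong_two_def carrier_cyclo_int)
  have "\<gamma> - 1 = - (\<gamma> * (\<beta> - 1))"
    using assms(1) by (simp add: algebra_simps)
  also have "\<dots> = 2 * int_eval (- (Q * S)) (zeta n)"
    by (simp add: S Q)
  finally show ?thesis
    unfolding cong_two_def carrier_cyclo_int by blast
qed

text \<open>If \<open>\<beta>\<close> is congruent to \<open>1\<close> modulo \<open>2\<close>, then so is its inverse, and therefore the inverse \<open>u(inverse \<beta>)\<close> of
  \<open>u(\<beta>)\<close> has integral coefficients as well.\<close>

lemma u_elem_normalized_unit_iff:
  fixes G (structure)
  assumes "n \<ge> 1" and "group G" and "x \<in> carrier G" and "generate G {x} = carrier G" and "Coset.order G = 2 ^ n"
    and unit: "\<beta> \<in> Units (cyclo_int n)"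
  shows "u_elem n G x \<beta> \<in> normalized_units int_ring G \<longleftrightarrow> cong_two n \<beta> 1"
proof -
  interpret group G by fact
  obtain \<gamma> where \<beta>: "\<beta> \<in> carrier (cyclo_int n)" and \<gamma>: "\<gamma> \<in> carrier (cyclo_int n)" "\<beta> * \<gamma> = 1"
    using unit unfolding cyclo_int_def Units_complex_subring by auto
  obtain P where P: "\<beta> = int_eval P (zeta n)"
    using \<beta> by (auto simp: carrier_cyclo_int)
  note bij = cyclic_power_bij[OF assms(3,4) _ assms(5)]
  have fin: "finite (carrier G)"
    using assms(5) order_gt_0_iff_finite by simp
  note mem = u_elem_in_group_ring_iff[OF assms(1-5)]
  show ?thesis
  proof
    assume "u_elem n G x \<beta> \<in> normalized_units int_ring G"
    then show "cong_two n \<beta> 1"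
      using mem[OF \<beta>] by (auto simp: normalized_units_def Units_def)
  next
    assume cong: "cong_two n \<beta> 1"
    have u: "u_elem n G x \<beta> \<in> carrier (group_ring int_ring G)"
      using mem[OF \<beta>] cong by simp
    have v: "u_elem n G x \<gamma> \<in> carrier (group_ring int_ring G)"
      using mem[OF \<gamma>(1)] cong_two_inverse[OF \<gamma>(2,1) cong] by simp
    have "u_elem n G x \<beta> \<in> Units (group_ring int_ring G)"
      using u v u_elem_mult_inverse[OF assms(1-5) \<beta> \<gamma>(1,2) u v]
        u_elem_mult_inverse[OF assms(1-5) \<gamma>(1) \<beta> _ v u] \<gamma>(2)
      by (auto simp: Units_def mult.commute)
    moreover have "augmentation int_ring G (u_elem n G x \<beta>) = 1"
    proof -
      have "augmentation int_ring G (u_elem n G x \<beta>) = (\<Sum>g\<in>carrier G. u_elem n G x \<beta> g)"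
        by (rule augmentation_int[OF fin u])
      also have "\<dots> = (\<Sum>j<(2::nat) ^ n. u_elem n G x \<beta> (x [^] j))"
        by (rule sum.reindex_bij_betw[symmetric]) (use bij(1) in simp)
      also have "\<dots> = 1"
        by (simp add: P u_elem_power[OF assms(1-5)] sum_u_poly_coeff[OF assms(1)])
      finally show ?thesis .
    qed
    ultimately show "u_elem n G x \<beta> \<in> normalized_units int_ring G"
      by (simp add: normalized_units_def)
  qed
qed

section \<open>Units of the cyclotomic integers\<close>

lemma comm_monoid_generate_ring: "comm_monoid (complex_subring (generate_ring complex_ring H))"
  by (rule comm_monoidI)
     (use generate_ring.intros(1,5)[where R = complex_ring and H = H] in \<open>auto simp: mult_ac\<close>)

lemma comm_group_units_cyclo_int: "comm_group (units_of (cyclo_int n))"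
  unfolding cyclo_int_def by (intro comm_monoid.units_comm_group comm_monoid_generate_ring)

lemma comm_group_units_real_cyclo_int: "comm_group (units_of (real_cyclo_int n))"
  unfolding real_cyclo_int_def by (intro comm_monoid.units_comm_group comm_monoid_generate_ring)

lemma units_cyclo_int_simps [simp]:
  "y \<otimes>\<^bsub>units_of (cyclo_int n)\<^esub> z = y * z"
  "\<one>\<^bsub>units_of (cyclo_int n)\<^esub> = 1"
  "carrier (units_of (cyclo_int n)) = Units (cyclo_int n)"
  "y \<otimes>\<^bsub>units_of (real_cyclo_int n)\<^esub> z = y * z"
  "\<one>\<^bsub>units_of (real_cyclo_int n)\<^esub> = 1"
  "carrier (units_of (real_cyclo_int n)) = Units (real_cyclo_int n)"
  by (simp_all add: cyclo_int_def real_cyclo_int_def units_of_def)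

lemma mem_Units_cyclo_int:
  "y \<in> Units (cyclo_int n) \<longleftrightarrow> y \<in> carrier (cyclo_int n) \<and> (\<exists>z\<in>carrier (cyclo_int n). y * z = 1)"
  by (simp add: cyclo_int_def Units_complex_subring)

lemma mem_Units_real_cyclo_int:
  "y \<in> Units (real_cyclo_int n) \<longleftrightarrow>
     y \<in> carrier (real_cyclo_int n) \<and> (\<exists>z\<in>carrier (real_cyclo_int n). y * z = 1)"
  by (simp add: real_cyclo_int_def Units_complex_subring)

lemma zeta_power_Units:
  assumes "n \<ge> 1"
  shows "zeta n ^ m \<in> Units (cyclo_int n)"
proof -
  have mem: "zeta n ^ j \<in> carrier (cyclo_int n)" for j
    unfolding carrier_cyclo_int by (rule range_eqI[of _ _ "monom 1 j"]) simp
  have "zeta n ^ m * zeta n ^ ((2 ^ n - 1) * m) = 1"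
    unfolding inverse_zeta_power[OF assms, symmetric] by (simp flip: power_mult_distrib)
  then show ?thesis
    using mem mem_Units_cyclo_int by blast
qed

lemma minus_one_Units_real: "-1 \<in> Units (real_cyclo_int n)"
proof -
  have "int_eval (-1) (zeta n + inverse (zeta n)) \<in> carrier (real_cyclo_int n)"
    unfolding carrier_real_cyclo_int by blast
  then show ?thesis
    by (auto simp: mem_Units_real_cyclo_int intro!: bexI[of _ "-1"])
qed

lemma generate_zeta:
  assumes "n \<ge> 1"
  shows "generate (units_of (cyclo_int n)) {zeta n} = range (\<lambda>m. zeta n ^ m)"
proof (intro equalityI subsetI)
  interpret comm_group "units_of (cyclo_int n)" by (rule comm_group_units_cyclo_int)
  fix y assume "y \<in> generate (units_of (cyclo_int n)) {zeta n}"
  then show "y \<in> range (\<lambda>m. zeta n ^ m)"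
  proof induction
    case one
    show ?case by (rule range_eqI[of _ _ 0]) simp
  next
    case (incl h)
    then show ?case by (intro range_eqI[of _ _ 1]) simp
  next
    case (inv h)
    have "zeta n ^ (2 ^ n - 1) * zeta n = 1"
      using inverse_zeta_power[OF assms, of 1, symmetric] by simp
    then have "inv\<^bsub>units_of (cyclo_int n)\<^esub> zeta n = zeta n ^ (2 ^ n - 1)"
      using zeta_power_Units[OF assms, of "2 ^ n - 1"] zeta_power_Units[OF assms, of 1]
      by (intro inv_equality) auto
    then show ?case
      using inv by blast
  next
    case (eng h1 h2)
    then obtain a b where "h1 = zeta n ^ a" "h2 = zeta n ^ b" by blast
    then show ?case by (intro range_eqI[of _ _ "a + b"]) (simp add: power_add)
  qed
next
  fix y assume "y \<in> range (\<lambda>m. zeta n ^ m)"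
  then obtain m where "y = zeta n ^ m" by blast
  moreover have "zeta n ^ m \<in> generate (units_of (cyclo_int n)) {zeta n}"
  proof (induction m)
    case 0
    show ?case
      using generate.one[of "units_of (cyclo_int n)"] by simp
  next
    case (Suc m)
    have "zeta n \<in> generate (units_of (cyclo_int n)) {zeta n}"
      by (rule generate.incl) simp
    from generate.eng[OF this Suc] show ?case by simp
  qed
  ultimately show "y \<in> generate (units_of (cyclo_int n)) {zeta n}" by simp
qed

lemma generate_minus_one: "generate (units_of (real_cyclo_int n)) {-1} = {1, -1}"
proof (intro equalityI subsetI)
  interpret comm_group "units_of (real_cyclo_int n)" by (rule comm_group_units_real_cyclo_int)
  fix y assume "y \<in> generate (units_of (real_cyclo_int n)) {-1}"
  then show "y \<in> {1, -1}"
  proof induction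
    case (inv h)
    have "inv\<^bsub>units_of (real_cyclo_int n)\<^esub> (-1) = -1"
      using minus_one_Units_real by (intro inv_equality) auto
    then show ?case
      using inv by simp
  qed auto
next
  fix y :: complex assume "y \<in> {1, -1}"
  then show "y \<in> generate (units_of (real_cyclo_int n)) {-1}"
    using generate.one[of "units_of (real_cyclo_int n)"] generate.incl[of "-1" "{-1}"] by auto
qed

text \<open>A unit \<open>zeta n ^ m * k\<close> with real \<open>k\<close> can only be real if the root of unity \<open>zeta n ^ m\<close> is real, that is, \<open>1\<close>
  or \<open>-1\<close>.\<close>

lemma real_unit_decomposition:
  assumes n: "n \<ge> 1"
    and K: "subgroup K (units_of (real_cyclo_int n))"
    and prod: "internal_direct_product (units_of (cyclo_int n))
           (generate (units_of (cyclo_int n)) {zeta n}) K"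
  shows "internal_direct_product (units_of (real_cyclo_int n))
           (generate (units_of (real_cyclo_int n)) {-1}) K"
proof -
  let ?U = "units_of (real_cyclo_int n)"
  interpret comm_group ?U by (rule comm_group_units_real_cyclo_int)
  have K_sub: "K \<subseteq> Units (real_cyclo_int n)"
    using subgroup.subset[OF K] by simp
  have "generate ?U {-1} \<lhd> ?U"
    by (intro subgroup_imp_normal generate_is_subgroup) (simp add: minus_one_Units_real)
  moreover have "K \<lhd> ?U"
    using K by (rule subgroup_imp_normal)
  moreover have "generate ?U {-1} \<inter> K = {\<one>\<^bsub>?U\<^esub>}"
  proof -
    have "-1 \<in> generate (units_of (cyclo_int n)) {zeta n}"
      unfolding generate_zeta[OF n] using zeta_in_roots_of_minus_one[OF n]
      by (intro range_eqI[of _ _ "2 ^ (n - 1)"]) simp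
    moreover have "generate (units_of (cyclo_int n)) {zeta n} \<inter> K = {1}"
      using prod by (simp add: internal_direct_product_def)
    ultimately have "-1 \<in> K \<Longrightarrow> (-1 :: complex) \<in> {1}"
      by blast
    then have "-1 \<notin> K"
      by auto
    moreover have "1 \<in> K"
      using subgroup.one_closed[OF K] by simp
    ultimately show ?thesis
      by (auto simp: generate_minus_one)
  qed
  moreover have "generate ?U {-1} <#>\<^bsub>?U\<^esub> K = carrier ?U"
  proof (intro equalityI subsetI)
    fix y assume "y \<in> generate ?U {-1} <#>\<^bsub>?U\<^esub> K"
    then obtain e k where "e \<in> {1, -1}" "k \<in> K" "y = e * k"
      unfolding set_mult_def generate_minus_one units_cyclo_int_simps by blast
    then show "y \<in> carrier ?U"
      using K_sub m_closed[of e k] m_closed[of 1 k] minus_one_Units_real one_closed by auto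
  next
    fix y assume y: "y \<in> carrier ?U"
    then have real: "y \<in> carrier (real_cyclo_int n)"
      by (simp add: mem_Units_real_cyclo_int)
    have "y \<in> Units (cyclo_int n)"
      using y real_cyclo_int_subset[OF n] by (auto simp: mem_Units_real_cyclo_int mem_Units_cyclo_int)
    then have "y \<in> generate (units_of (cyclo_int n)) {zeta n} <#>\<^bsub>units_of (cyclo_int n)\<^esub> K"
      using prod by (simp add: internal_direct_product_def)
    then obtain m k where k: "k \<in> K" and y_eq: "y = zeta n ^ m * k"
      by (auto simp: set_mult_def generate_zeta[OF n])
    have k_real: "k \<in> carrier (real_cyclo_int n)" and "k \<noteq> 0"
      using k K_sub by (auto simp: mem_Units_real_cyclo_int)
    have "inverse (zeta n) ^ m * k = zeta n ^ m * k"
      using cnj_real_cyclo_int[OF real] cnj_real_cyclo_int[OF k_real] by (simp add: y_eq cnj_zeta)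
    then have "zeta n ^ m * zeta n ^ m = zeta n ^ m * inverse (zeta n) ^ m"
      using \<open>k \<noteq> 0\<close> by simp
    then have "(zeta n ^ m)\<^sup>2 = 1"
      by (simp add: power2_eq_square flip: power_mult_distrib)
    then have "zeta n ^ m \<in> {1, -1}"
      by (simp add: power2_eq_1_iff)
    then show "y \<in> generate ?U {-1} <#>\<^bsub>?U\<^esub> K"
      unfolding generate_minus_one set_mult_def using k y_eq by auto
  qed
  ultimately show ?thesis
    by (simp add: internal_direct_product_def)
qed

text \<open>Write \<open>\<beta> = zeta n ^ m * k\<close> with real \<open>k\<close>, so that \<open>\<beta> = zeta n ^ (2 * m) * cnj \<beta>\<close>. As \<open>\<beta>\<close> and its conjugate are
  congruent to \<open>1\<close> modulo \<open>2\<close>, the trace of \<open>zeta n ^ (2 * m)\<close> divided by the degree \<open>2 ^ (n - 1)\<close> is an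
  odd integer. Since the trace of a root of unity other than \<open>1\<close> and \<open>-1\<close> is zero, \<open>zeta n ^ (2 * m)\<close> is
  \<open>1\<close> or \<open>-1\<close>. The value \<open>-1\<close> would mean \<open>cnj \<beta> = - \<beta>\<close>; then \<open>\<beta>\<close> would have trace zero, but its
  trace divided by the degree is odd as well. Hence \<open>zeta n ^ m\<close> is \<open>1\<close> or \<open>-1\<close>.\<close>

lemma cong_two_imp_real:
  assumes n: "n \<ge> 1"
    and K: "subgroup K (units_of (real_cyclo_int n))"
    and prod: "internal_direct_product (units_of (cyclo_int n))
           (generate (units_of (cyclo_int n)) {zeta n}) K"
    and \<beta>: "\<beta> \<in> Units (cyclo_int n)" and cong: "cong_two n \<beta> 1"
  shows "\<beta> \<in> Units (real_cyclo_int n)"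
proof -
  let ?k = "n - 1" and ?M = "2 ^ n - 1 :: nat"
  let ?R = "roots_of_minus_one ?k"
  have K_sub: "K \<subseteq> Units (real_cyclo_int n)"
    using subgroup.subset[OF K] by simp
  have "\<beta> \<in> generate (units_of (cyclo_int n)) {zeta n} <#>\<^bsub>units_of (cyclo_int n)\<^esub> K"
    using prod \<beta> by (simp add: internal_direct_product_def)
  then obtain m k where k: "k \<in> K" and \<beta>_eq: "\<beta> = zeta n ^ m * k"
    by (auto simp: set_mult_def generate_zeta[OF n])
  have k_unit: "k \<in> Units (real_cyclo_int n)"
    using k K_sub by blast
  have cnj_k: "cnj k = k"
    using k_unit cnj_real_cyclo_int[of k n] by (simp add: mem_Units_real_cyclo_int)
  obtain S where "\<beta> - 1 = 2 * int_eval S (zeta n)"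
    using cong by (auto simp: cong_two_def carrier_cyclo_int)
  then have S: "\<beta> = 1 + 2 * int_eval S (zeta n)"
    by (simp add: eq_diff_eq algebra_simps)
  \<comment> \<open>the exponent of \<open>X\<close> makes \<open>S'\<close> take at each root the value of \<open>S\<close> at the inverse, which is the complex conjugate\<close>
  define S' where "S' = pcompose S (monom 1 ?M)"
  have S'_eval: "int_eval S' z = int_eval S (inverse z)" if "z \<in> ?R" for z
    using inverse_power_root_of_minus_one[OF that, of 1] n by (simp add: S'_def)
  have cnj_\<beta>: "cnj \<beta> = 1 + 2 * int_eval S' (zeta n)"
    using zeta_in_roots_of_minus_one[OF n] by (simp add: S cnj_int_eval cnj_zeta S'_eval)
  have "zeta n ^ (2 * m) * cnj \<beta> = \<beta>"
  proof -
    have "zeta n ^ (2 * m) * cnj \<beta> = zeta n ^ m * (zeta n ^ m * inverse (zeta n) ^ m) * k"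
      unfolding mult_2 power_add by (simp only: \<beta>_eq complex_cnj_mult complex_cnj_power cnj_zeta cnj_k mult_ac)
    also have "zeta n ^ m * inverse (zeta n) ^ m = 1"
      by (simp flip: power_mult_distrib)
    finally show ?thesis
      by (simp add: \<beta>_eq)
  qed
  then have "zeta n ^ (2 * m) * (1 + 2 * int_eval S' (zeta n)) = 1 + 2 * int_eval S (zeta n)"
    unfolding cnj_\<beta> unfolding S .
  then have root: "int_eval (monom 1 (2 * m) * (1 + 2 * S') - (1 + 2 * S)) (zeta n) = 0"
    by simp
  have conj_eq: "z ^ (2 * m) * (1 + 2 * int_eval S' z) = 1 + 2 * int_eval S z" if "z \<in> ?R" for z
  proof -
    have "int_eval (monom 1 (2 * m) * (1 + 2 * S') - (1 + 2 * S)) z = 0"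
      by (rule int_eval_zero_transfer[OF _ _ root])
         (use zeta_in_roots_of_minus_one[OF n] that in simp_all)
    then show ?thesis by simp
  qed
  obtain s :: int where s: "(\<Sum>z\<in>?R. int_eval S z) = 2 ^ ?k * of_int s"
    using sum_int_eval_roots_divisible by blast
  obtain t :: int where t: "(\<Sum>z\<in>?R. int_eval (monom 1 (2 * m) * S') z) = 2 ^ ?k * of_int t"
    using sum_int_eval_roots_divisible by blast
  have odd_nonzero: "(1 + 2 * of_int c :: complex) \<noteq> 0" for c
  proof
    assume "(1 + 2 * of_int c :: complex) = 0"
    then have "of_int (1 + 2 * c) = (of_int 0 :: complex)" by simp
    then show False by (simp only: of_int_eq_iff) presburger
  qed
  have "(\<Sum>z\<in>?R. z ^ (2 * m)) = (\<Sum>z\<in>?R. 1 + 2 * int_eval S z - 2 * int_eval (monom 1 (2 * m) * S') z)"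
  proof (intro sum.cong refl)
    fix z assume "z \<in> ?R"
    from conj_eq[OF this]
    show "z ^ (2 * m) = 1 + 2 * int_eval S z - 2 * int_eval (monom 1 (2 * m) * S') z"
      by (simp add: algebra_simps)
  qed
  also have "\<dots> = 2 ^ ?k * (1 + 2 * of_int (s - t))"
    unfolding sum_subtractf sum.distrib sum_distrib_left[symmetric] s t
    by (simp add: card_roots_of_minus_one algebra_simps)
  finally have "(\<Sum>z\<in>?R. z ^ (2 * m)) \<noteq> 0"
    using odd_nonzero[of "s - t"] by simp
  then have "2 ^ ?k dvd 2 * m"
    by (auto simp: sum_power_roots_of_minus_one split: if_splits)
  then obtain q where q: "2 * m = 2 ^ ?k * q" ..
  have pow: "z ^ (2 * m) = (-1) ^ q" if "z \<in> ?R" for z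
    using that by (simp add: q power_mult)
  have "even q"
  proof (rule ccontr)
    assume "odd q"
    have "(\<Sum>z\<in>?R. 1 + 2 * int_eval S z) = (\<Sum>z\<in>?R. - (1 + 2 * int_eval S (inverse z)))"
    proof (intro sum.cong refl)
      fix z assume z: "z \<in> ?R"
      show "1 + 2 * int_eval S z = - (1 + 2 * int_eval S (inverse z))"
        unfolding conj_eq[OF z, symmetric] pow[OF z] S'_eval[OF z] using \<open>odd q\<close> by simp
    qed
    also have "\<dots> = (\<Sum>z\<in>?R. - (1 + 2 * int_eval S z))"
      by (rule sum.reindex_bij_witness[of _ inverse inverse]) (auto simp: power_inverse)
    also have "\<dots> = - (\<Sum>z\<in>?R. 1 + 2 * int_eval S z)"
      by (rule sum_negf)
    finally have "2 * (\<Sum>z\<in>?R. 1 + 2 * int_eval S z) = 0"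
      by (simp only: eq_neg_iff_add_eq_0 mult_2)
    then have "(\<Sum>z\<in>?R. 1 + 2 * int_eval S z) = 0"
      by (simp only: mult_eq_0_iff) simp
    then have "2 ^ ?k * (1 + 2 * of_int s :: complex) = 0"
      unfolding sum.distrib sum_distrib_left[symmetric] s
      by (simp add: card_roots_of_minus_one algebra_simps)
    with odd_nonzero[of s] show False by simp
  qed
  then have "(zeta n ^ m)\<^sup>2 = 1"
    using pow[OF zeta_in_roots_of_minus_one[OF n]] by (simp add: mult.commute flip: power_mult)
  then have "\<beta> = k \<or> \<beta> = -1 * k"
    by (auto simp: \<beta>_eq power2_eq_1_iff)
  moreover interpret comm_group "units_of (real_cyclo_int n)" by (rule comm_group_units_real_cyclo_int)
  have "-1 * k \<in> Units (real_cyclo_int n)"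
    using m_closed[of "-1" k] minus_one_Units_real k_unit by simp
  ultimately show ?thesis
    using k_unit by auto
qed

theorem mainTheorem2:
  fixes n :: nat
    and G :: "('g, 'm) monoid_scheme" and x :: 'g
    and K :: "complex set" and \<beta> :: complex
  assumes "n \<ge> 1"
    and "group G" and "x \<in> carrier G" and "generate G {x} = carrier G" and "Coset.order G = 2 ^ n"
    and "subgroup K (units_of (real_cyclo_int n))"
    and "internal_direct_product (units_of (cyclo_int n))
           (generate (units_of (cyclo_int n)) {zeta n}) K"
    and "\<beta> \<in> Units (cyclo_int n)"
  shows "internal_direct_product (units_of (real_cyclo_int n))
           (generate (units_of (real_cyclo_int n)) {-1}) K
         \<and> (u_elem n G x \<beta> \<in> normalized_units (complex_subring \<int>) G
            \<longleftrightarrow> \<beta> \<in> Units (real_cyclo_int n) \<and> cong_two n \<beta> 1)"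
  using real_unit_decomposition[OF assms(1,6,7)] u_elem_normalized_unit_iff[OF assms(1-5,8)]
    cong_two_imp_real[OF assms(1,6-8)] by blast

end
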